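(* For all $z\in\Omega$ with $|z|_\Im$ sufficiently large, the following series converge in $\mathbb T^2$ and $$\mathcal E_1(z)=\binom{0}{-L(\chi_t,1)}+\widetilde\pi\sum_{a\in A_+}\binom{-a(t)}{\chi_t(az)}u(az),$$ $$\mathcal E_q(z)=\binom{0}{-L(\chi_t,q)+\frac{\widetilde\pi^q}{\tau(\omega)}\sum_{a\in A_+}u(az)^{q-1}}+\widetilde\pi^q\sum_{a\in A_+}\binom{-a(t)}{\chi_t(az)}u(az)^q.$$
   Context: Notation: $q$ a prime power, $A=\mathbb F_q[\theta]$, $A_+$ its monic elements, $K_\infty=\mathbb F_q((1/\theta))$, $\mathbb C_\infty$ the completion of an algebraic closure of $K_\infty$, $\Omega=\mathbb C_\infty\setminus K_\infty$, $|z|_\Im=\inf_{\kappa\in K_\infty}|z-\kappa|$. $\mathbb T$ is the Tate algebra of series $\sum f_it^i$ with $f_i\in\mathbb C_\infty$, $f_i\to0$ (Gauss norm), and $\tau(\sum f_it^i)=\sum f_i^qt^i$. For $a\in A$, $a(t)$ is its image under $\theta\mapsto t$. $\widetilde\pi$ is the Carlitz period, $u(z)=\widetilde\pi^{-1}\sum_{a\in A}(z-a)^{-1}$. Let $D_0=1$, $D_j=\prod_{i=0}^{j-1}(\theta^{q^j}-\theta^{q^i})$, $\omega(t)=\sum_{j\ge0}\frac{\widetilde\pi^{q^j}}{(\theta^{q^j}-t)D_j}$, and for $z\in\mathbb C_\infty$, $\chi_t(z)=\omega(t)^{-1}\sum_{j\ge0}\frac{\widetilde\pi^{q^j}z^{q^j}}{(\theta^{q^j}-t)D_j}\in\mathbb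 T$ (so $\chi_t(a)=a(t)$ for $a\in A$). $\mathcal E_k(z)=\sum_{(a,b)\in A^2\setminus\{(0,0)\}}(az+b)^{-k}\binom{a(t)}{b(t)}$ and $L(\chi_t,k)=\sum_{a\in A_+}a(t)a^{-k}\in\mathbb T$. *)

theory Defs
  imports "HOL-Computational_Algebra.Computational_Algebra" "HOL-Library.Cardinality"
begin

text \<open>F_q is a finite field type 'f (q = CARD('f)); A = F_q[theta] is 'f poly;
K_infty = F_q((1/theta)) is 'f fls with formal variable X = 1/theta, so theta = fls_X_inv.
C_infty is an abstract field type 'c with absolute value nrm and embedding iota of K_infty,
characterised (up to isometric K_infty-isomorphism) by the predicate is_Cinfty.\<close>

definition Kabs :: "'f::{field,finite} fls \<Rightarrow> real" where
  "Kabs (f :: 'f fls) = (if f = 0 then 0 else real (CARD('f)) powr (- real_of_int (fls_subdegree f)))"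

definition tends :: "('c \<Rightarrow> real) \<Rightarrow> (nat \<Rightarrow> 'c::ab_group_add) \<Rightarrow> 'c \<Rightarrow> bool" where
  "tends nrm s L \<longleftrightarrow> (\<forall>e>0. \<exists>N. \<forall>n\<ge>N. nrm (s n - L) < e)"

definition clim :: "('c \<Rightarrow> real) \<Rightarrow> (nat \<Rightarrow> 'c::ab_group_add) \<Rightarrow> 'c" where
  "clim nrm s = (THE L. tends nrm s L)"

definition is_Cinfty :: "('f::{field,finite} fls \<Rightarrow> 'c::field) \<Rightarrow> ('c \<Rightarrow> real) \<Rightarrow> bool" where
  "is_Cinfty \<iota> nrm \<longleftrightarrow>
     \<comment> \<open>non-archimedean absolute value\<close>
     (\<forall>x. nrm x \<ge> 0) \<and> (\<forall>x. nrm x = 0 \<longleftrightarrow> x = 0) \<and>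
     (\<forall>x y. nrm (x * y) = nrm x * nrm y) \<and> (\<forall>x y. nrm (x + y) \<le> max (nrm x) (nrm y)) \<and>
     \<comment> \<open>iota is a field embedding of K_infty extending its absolute value\<close>
     \<iota> 1 = 1 \<and> (\<forall>x y. \<iota> (x + y) = \<iota> x + \<iota> y) \<and> (\<forall>x y. \<iota> (x * y) = \<iota> x * \<iota> y) \<and>
     (\<forall>x. nrm (\<iota> x) = Kabs x) \<and>
     \<comment> \<open>complete\<close>
     (\<forall>s. (\<forall>e>0. \<exists>N. \<forall>m\<ge>N. \<forall>n\<ge>N. nrm (s m - s n) < e) \<longrightarrow> (\<exists>L. tends nrm s L)) \<and>
     \<comment> \<open>algebraically closed\<close>
     (\<forall>p :: 'c poly. degree p \<ge> 1 \<longrightarrow> (\<exists>x. poly p x = 0)) \<and>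
     \<comment> \<open>the algebraic closure of K_infty is dense\<close>
     (\<forall>c e. e > 0 \<longrightarrow> (\<exists>d. nrm (c - d) < e \<and>
         (\<exists>p :: 'f fls poly. p \<noteq> 0 \<and> poly (map_poly \<iota> p) d = 0)))"

definition theta :: "('f::{field,finite} fls \<Rightarrow> 'c::field) \<Rightarrow> 'c" where
  "theta \<iota> = \<iota> fls_X_inv"

definition Ac :: "('f::{field,finite} fls \<Rightarrow> 'c::field) \<Rightarrow> 'f poly \<Rightarrow> 'c" where
  "Ac \<iota> a = poly (map_poly (\<lambda>c. \<iota> (fls_const c)) a) (theta \<iota>)"

definition At :: "('f::{field,finite} fls \<Rightarrow> 'c::field) \<Rightarrow> 'f poly \<Rightarrow> 'c fps" where
  "At \<iota> a = Abs_fps (\<lambda>i. \<iota> (fls_const (coeff a i)))"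

definition Aplus :: "'f::{field,finite} poly set" where
  "Aplus = {a. lead_coeff a = 1}"

definition Dc :: "('f::{field,finite} fls \<Rightarrow> 'c::field) \<Rightarrow> nat \<Rightarrow> 'c" where
  "Dc \<iota> j = (\<Prod>i<j. theta \<iota> ^ (CARD('f) ^ j) - theta \<iota> ^ (CARD('f) ^ i))"

text \<open>pi is a Carlitz period: the kernel of the Carlitz exponential is pi*A\<close>
definition carlitz_period :: "('f::{field,finite} fls \<Rightarrow> 'c::field) \<Rightarrow> ('c \<Rightarrow> real) \<Rightarrow> 'c \<Rightarrow> bool" where
  "carlitz_period \<iota> nrm p \<longleftrightarrow>
     (\<forall>z. tends nrm (\<lambda>n. \<Sum>j<n. z ^ (CARD('f) ^ j) / Dc \<iota> j) 0 \<longleftrightarrow> (\<exists>a. z = p * Ac \<iota> a))"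

definition Omega :: "('f::{field,finite} fls \<Rightarrow> 'c::field) \<Rightarrow> 'c set" where
  "Omega \<iota> = UNIV - range \<iota>"

definition imnorm :: "('f::{field,finite} fls \<Rightarrow> 'c::field) \<Rightarrow> ('c \<Rightarrow> real) \<Rightarrow> 'c \<Rightarrow> real" where
  "imnorm \<iota> nrm z = Inf (range (\<lambda>k. nrm (z - \<iota> k)))"

definition Csum :: "('c \<Rightarrow> real) \<Rightarrow> ('i \<Rightarrow> 'c::ab_group_add) \<Rightarrow> 'i set \<Rightarrow> 'c \<Rightarrow> bool" where
  "Csum nrm g S s \<longleftrightarrow> (\<forall>e>0. \<exists>F0. finite F0 \<and> F0 \<subseteq> S \<and>
      (\<forall>F. finite F \<and> F0 \<subseteq> F \<and> F \<subseteq> S \<longrightarrow> nrm ((\<Sum>x\<in>F. g x) - s) < e))"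

text \<open>unconditional convergence in the Tate algebra T (Gauss norm), T inside 'c fps\<close>
definition Tsum :: "('c \<Rightarrow> real) \<Rightarrow> ('i \<Rightarrow> 'c::field fps) \<Rightarrow> 'i set \<Rightarrow> 'c fps \<Rightarrow> bool" where
  "Tsum nrm g S s \<longleftrightarrow> (\<forall>e>0. \<exists>F0. finite F0 \<and> F0 \<subseteq> S \<and>
      (\<forall>F. finite F \<and> F0 \<subseteq> F \<and> F \<subseteq> S \<longrightarrow> (\<forall>i. nrm ((\<Sum>x\<in>F. g x) $ i - s $ i) \<le> e)))"

definition in_T :: "('c \<Rightarrow> real) \<Rightarrow> 'c::field fps \<Rightarrow> bool" where
  "in_T nrm f \<longleftrightarrow> tends nrm (\<lambda>i. f $ i) 0"

definition ttau :: "'f::{field,finite} itself \<Rightarrow> 'c::field fps \<Rightarrow> 'c fps" where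
  "ttau _ f = Abs_fps (\<lambda>i. (f $ i) ^ CARD('f))"

text \<open>omega(t) = sum_j pi^(q^j) / ((theta^(q^j) - t) D_j); coefficient of t^i\<close>
definition omega :: "('f::{field,finite} fls \<Rightarrow> 'c::field) \<Rightarrow> ('c \<Rightarrow> real) \<Rightarrow> 'c \<Rightarrow> 'c fps" where
  "omega \<iota> nrm p = Abs_fps (\<lambda>i. clim nrm (\<lambda>n. \<Sum>j<n.
      p ^ (CARD('f) ^ j) / (theta \<iota> ^ (CARD('f) ^ j * (i + 1)) * Dc \<iota> j)))"

definition chi :: "('f::{field,finite} fls \<Rightarrow> 'c::field) \<Rightarrow> ('c \<Rightarrow> real) \<Rightarrow> 'c \<Rightarrow> 'c \<Rightarrow> 'c fps" where
  "chi \<iota> nrm p z = inverse (omega \<iota> nrm p) * Abs_fps (\<lambda>i. clim nrm (\<lambda>n. \<Sum>j<n.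
      p ^ (CARD('f) ^ j) * z ^ (CARD('f) ^ j) / (theta \<iota> ^ (CARD('f) ^ j * (i + 1)) * Dc \<iota> j)))"

definition uu :: "('f::{field,finite} fls \<Rightarrow> 'c::field) \<Rightarrow> ('c \<Rightarrow> real) \<Rightarrow> 'c \<Rightarrow> 'c \<Rightarrow> 'c" where
  "uu \<iota> nrm p z = inverse p * (THE s. Csum nrm (\<lambda>a. inverse (z - Ac \<iota> a)) (UNIV :: 'f poly set) s)"

end

theory Submission
  imports Defs
begin

text \<open>
  Let \<open>e(x) = \<Sum>\<^sub>j x\<^bsup>q^j\<^esup> / D\<^sub>j\<close> be the Carlitz exponential. The coefficients of \<open>\<omega>\<close> and \<open>\<omega> \<chi>\<^sub>t(x)\<close>
  at \<open>t\<^sup>i\<close> are \<open>e(\<pi> / \<theta>\<^bsup>i+1\<^esup>)\<close> and \<open>e(\<pi> x / \<theta>\<^bsup>i+1\<^esup>)\<close>. Lagrange interpolation on the finite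
  group of polynomials \<open>b\<close> of degree less than \<open>d\<close> shows that \<open>\<Sum>\<^sub>b (x - b)\<^bsup>q^j - 1\<^esup>\<close> vanishes for
  \<open>j < d\<close> and does not depend on \<open>x\<close> for \<open>j = d\<close>. Expanding \<open>\<Sum>\<^sub>b e(y (x - b)) / (x - b)\<close> into powers
  of \<open>x - b\<close> and letting \<open>d\<close> tend to infinity therefore gives \<open>0\<close> when \<open>|y| \<le> q\<close>, and a constant when
  \<open>y = \<pi>\<close>, since \<open>|\<pi>| \<le> q\<^sup>2\<close>. By additivity of \<open>e\<close> these two facts read
  \<open>\<Sum>\<^sub>b b(t) / (x - b) = \<pi> u(x) \<chi>\<^sub>t(x)\<close> and \<open>u(x) = 1 / e(\<pi> x)\<close>. The weight \<open>q\<close> version follows by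
  applying \<open>\<tau>\<close>, because \<open>e(\<theta> x) = \<theta> e(x) + e(x)\<^sup>q\<close> yields \<open>\<tau>(\<chi>\<^sub>t(x)) = \<chi>\<^sub>t(x) + e(\<pi> x) / \<tau>(\<omega>)\<close>.
\<close>

subsection \<open>Non-Archimedean fields\<close>

text \<open>The hypotheses describe the period only through the kernel of e, so its size has to be
  extracted. Algebraic closedness supplies a theta-torsion point of norm at most q, hence a nonzero
  period of norm at most q^2, and a generator of the period lattice cannot be larger than that. The
  bound is exactly what the interpolation tolerates: for |y| <= q^k the expansion over polynomials
  of degree below d can be cut off after the exponent j = d + k - 2. For k = 1 all power sums
  vanish, for k = 2 one constant term survives, and a larger period would bring in power sums that
  depend on x. The interpolation evaluates a sum only along the subgroups of bounded degree, whereas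
  the claims are about unconditional convergence. Each sum is therefore first shown to exist,
  because its terms tend to zero, and its value is then read off along this one sequence of
  subgroups.\<close>

locale nonarch_field =
  fixes nrm :: "'c::field \<Rightarrow> real"
  assumes nrm_ge_0 [simp]: "nrm x \<ge> 0"
    and nrm_eq_0 [simp]: "nrm x = 0 \<longleftrightarrow> x = 0"
    and nrm_mult: "nrm (x * y) = nrm x * nrm y"
    and nrm_add: "nrm (x + y) \<le> max (nrm x) (nrm y)"
    and complete: "(\<And>e. e > 0 \<Longrightarrow> \<exists>N. \<forall>m\<ge>N. \<forall>n\<ge>N. nrm (s m - s n) < e) \<Longrightarrow> \<exists>L. tends nrm s L"
begin

lemma nrm_0 [simp]: "nrm 0 = 0"
  by simp

lemma nrm_1 [simp]: "nrm 1 = 1"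
proof -
  have "nrm 1 * nrm 1 = nrm 1 * 1"
    using nrm_mult[of 1 1] by simp
  thus ?thesis
    by (subst (asm) mult_cancel_left) simp
qed

lemma nrm_pos [simp]: "nrm x > 0 \<longleftrightarrow> x \<noteq> 0"
  using nrm_ge_0[of x] nrm_eq_0[of x] by linarith

lemma nrm_power: "nrm (x ^ n) = nrm x ^ n"
  by (induction n) (simp_all add: nrm_mult)

lemma nrm_inverse: "nrm (inverse x) = inverse (nrm x)"
proof (cases "x = 0")
  case False
  hence "nrm x * nrm (inverse x) = 1"
    by (simp flip: nrm_mult)
  thus ?thesis
    by (simp add: inverse_unique)
qed simp

lemma nrm_divide: "nrm (x / y) = nrm x / nrm y"
  by (simp add: divide_inverse nrm_mult nrm_inverse)

lemma nrm_prod: "nrm (prod f A) = (\<Prod>x\<in>A. nrm (f x))"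
  by (induction A rule: infinite_finite_induct) (simp_all add: nrm_mult)

lemma nrm_minus [simp]: "nrm (- x) = nrm x"
proof -
  have "nrm (-1) ^ 2 = 1"
    by (simp flip: nrm_power)
  hence "nrm (-1) = 1"
    using nrm_ge_0[of "-1"] by (simp add: power2_eq_1_iff)
  thus ?thesis
    using nrm_mult[of "-1" x] by simp
qed

lemma nrm_minus_commute: "nrm (x - y) = nrm (y - x)"
  using nrm_minus[of "x - y"] by simp

lemma nrm_add_le: "nrm x \<le> B \<Longrightarrow> nrm y \<le> B \<Longrightarrow> nrm (x + y) \<le> B"
  using nrm_add[of x y] by linarith

lemma nrm_diff_le: "nrm x \<le> B \<Longrightarrow> nrm y \<le> B \<Longrightarrow> nrm (x - y) \<le> B"
  using nrm_add_le[of x B "- y"] by simp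

lemma nrm_add_eq:
  assumes "nrm y < nrm x"
  shows "nrm (x + y) = nrm x"
proof (rule antisym)
  show "nrm (x + y) \<le> nrm x"
    using assms by (intro nrm_add_le) auto
  show "nrm x \<le> nrm (x + y)"
    using nrm_add[of "x + y" "- y"] assms by auto
qed

lemma nrm_diff_eq: "nrm y < nrm x \<Longrightarrow> nrm (x - y) = nrm x"
  using nrm_add_eq[of "- y" x] by simp

lemma nrm_sum_le:
  assumes "\<And>x. x \<in> A \<Longrightarrow> nrm (f x) \<le> B" "B \<ge> 0"
  shows "nrm (sum f A) \<le> B"
  using assms(1)
  by (induction A rule: infinite_finite_induct) (auto intro!: nrm_add_le assms(2))

lemma eq_if_close:
  assumes "\<And>e. e > 0 \<Longrightarrow> nrm (x - y) \<le> e"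
  shows "x = y"
proof -
  have "nrm (x - y) \<le> 0"
    by (rule field_le_epsilon) (simp add: assms)
  thus ?thesis
    using nrm_ge_0[of "x - y"] by (simp add: antisym)
qed

subsection \<open>Limits of sequences\<close>

lemma tendsI: "(\<And>e. e > 0 \<Longrightarrow> \<exists>N. \<forall>n\<ge>N. nrm (s n - L) < e) \<Longrightarrow> tends nrm s L"
  by (simp add: tends_def)

lemma tendsD: "tends nrm s L \<Longrightarrow> e > 0 \<Longrightarrow> \<exists>N. \<forall>n\<ge>N. nrm (s n - L) \<le> e"
  unfolding tends_def by (meson less_imp_le)

lemma tends_unique:
  assumes "tends nrm s L" "tends nrm s L'"
  shows "L = L'"
proof (rule eq_if_close)
  fix e :: real assume e: "e > 0"
  obtain N where N: "\<And>n. n \<ge> N \<Longrightarrow> nrm (s n - L) \<le> e"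
    using tendsD[OF assms(1) e] by blast
  obtain M where M: "\<And>n. n \<ge> M \<Longrightarrow> nrm (s n - L') \<le> e"
    using tendsD[OF assms(2) e] by blast
  have "nrm ((s (max M N) - L') - (s (max M N) - L)) \<le> e"
    by (intro nrm_diff_le N M) auto
  thus "nrm (L - L') \<le> e"
    by simp
qed

lemma clim_eq: "tends nrm s L \<Longrightarrow> clim nrm s = L"
  unfolding clim_def using tends_unique by blast

lemma tends_dominated:
  assumes "tends nrm s L" "\<And>n. n \<ge> N \<Longrightarrow> nrm (r n - M) \<le> C * nrm (s n - L)"
  shows "tends nrm r M"
proof (rule tendsI)
  fix e :: real assume "e > 0"
  \<comment> \<open>Passing to \<open>max C 1\<close> permits the division below even for
    \<open>C = 0\<close>, which occurs for multiplication by zero.\<close>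
  define D where "D = max C 1"
  have D: "D > 0" "C \<le> D"
    by (auto simp: D_def)
  hence "e / D > 0"
    using \<open>e > 0\<close> by simp
  then obtain K where K: "\<And>n. n \<ge> K \<Longrightarrow> nrm (s n - L) < e / D"
    using assms(1) unfolding tends_def by blast
  show "\<exists>N. \<forall>n\<ge>N. nrm (r n - M) < e"
  proof (intro exI allI impI)
    fix n assume n: "n \<ge> max K N"
    have "nrm (r n - M) \<le> C * nrm (s n - L)"
      using n by (intro assms(2)) auto
    also have "\<dots> \<le> D * nrm (s n - L)"
      using D by (intro mult_right_mono) auto
    also have "\<dots> < e"
      using K[of n] n D by (simp add: field_simps)
    finally show "nrm (r n - M) < e" .
  qed
qed

lemma tends_add:
  assumes "tends nrm s L" "tends nrm r M"
  shows "tends nrm (\<lambda>n. s n + r n) (L + M)"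
proof (rule tendsI)
  fix e :: real assume "e > 0"
  then obtain K K' where "\<And>n. n \<ge> K \<Longrightarrow> nrm (s n - L) < e" "\<And>n. n \<ge> K' \<Longrightarrow> nrm (r n - M) < e"
    using assms unfolding tends_def by blast
  hence "nrm ((s n - L) + (r n - M)) < e" if "n \<ge> max K K'" for n
    using nrm_add[of "s n - L" "r n - M"] that by fastforce
  thus "\<exists>N. \<forall>n\<ge>N. nrm (s n + r n - (L + M)) < e"
    by (auto simp: algebra_simps intro!: exI[of _ "max K K'"])
qed

lemma tends_cmult:
  assumes "tends nrm s L"
  shows "tends nrm (\<lambda>n. c * s n) (c * L)"
  by (rule tends_dominated[OF assms, of 0 _ _ "nrm c"])
     (simp add: nrm_mult flip: right_diff_distrib)

lemma tends_minus:
  assumes "tends nrm s L"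
  shows "tends nrm (\<lambda>n. - s n) (- L)"
  using tends_cmult[OF assms, of "-1"] by simp

lemma tends_diff:
  assumes "tends nrm s L" "tends nrm r M"
  shows "tends nrm (\<lambda>n. s n - r n) (L - M)"
  using tends_add[OF assms(1) tends_minus[OF assms(2)]] by simp

lemma tends_Suc_iff: "tends nrm (\<lambda>n. s (Suc n)) L \<longleftrightarrow> tends nrm s L"
proof
  assume *: "tends nrm (\<lambda>n. s (Suc n)) L"
  show "tends nrm s L"
  proof (rule tendsI)
    fix e :: real assume "e > 0"
    then obtain N where N: "\<And>n. n \<ge> N \<Longrightarrow> nrm (s (Suc n) - L) < e"
      using * unfolding tends_def by blast
    have "nrm (s n - L) < e" if "n \<ge> Suc N" for n
      using N[of "n - 1"] that by simp
    thus "\<exists>N. \<forall>n\<ge>N. nrm (s n - L) < e"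
      by blast
  qed
next
  assume "tends nrm s L"
  thus "tends nrm (\<lambda>n. s (Suc n)) L"
    unfolding tends_def by (meson le_SucI)
qed

lemma tends_nrm_le:
  assumes "tends nrm s L" "\<And>n. n \<ge> N \<Longrightarrow> nrm (s n - c) \<le> B"
  shows "nrm (L - c) \<le> B"
proof (rule field_le_epsilon)
  fix e :: real assume "e > 0"
  obtain K where K: "\<And>n. n \<ge> K \<Longrightarrow> nrm (s n - L) \<le> e"
    using tendsD[OF assms(1) \<open>e > 0\<close>] by blast
  define n where "n = max K N"
  have "nrm (s n - L) \<le> e" "nrm (s n - c) \<le> B"
    by (auto simp: n_def intro!: K assms(2))
  moreover have "nrm (L - c) \<le> max (nrm (s n - c)) (nrm (s n - L))"
    using nrm_add[of "s n - c" "L - s n"] by (simp add: nrm_minus_commute)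
  ultimately show "nrm (L - c) \<le> B + e"
    using \<open>e > 0\<close> nrm_ge_0[of "s n - c"] by linarith
qed

lemma Cauchy_telescope:
  assumes "\<And>n. n \<ge> N \<Longrightarrow> nrm (s (Suc n) - s n) \<le> e" "N \<le> m" "N \<le> n" "e \<ge> 0"
  shows "nrm (s m - s n) \<le> e"
proof -
  have "nrm (s k - s N) \<le> e" if "k \<ge> N" for k
    using that
  proof (induction k rule: dec_induct)
    case (step k)
    have "nrm ((s (Suc k) - s k) + (s k - s N)) \<le> e"
      by (intro nrm_add_le step assms)
    thus ?case
      by simp
  qed (use assms in simp)
  from nrm_diff_le[OF this[OF assms(2)] this[OF assms(3)]]
  show ?thesis
    by simp
qed

text \<open>By the ultrametric inequality a difference is bounded by the largest step in between, so
  small steps already make the sequence Cauchy.\<close>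

lemma convergent_if_steps_tend_0:
  assumes "tends nrm (\<lambda>n. s (Suc n) - s n) 0"
  obtains L where "tends nrm s L"
proof -
  have "\<exists>N. \<forall>m\<ge>N. \<forall>n\<ge>N. nrm (s m - s n) < e" if "e > 0" for e
  proof -
    have "e / 2 > 0"
      using that by simp
    from tendsD[OF assms this] obtain N
      where N: "\<And>n. n \<ge> N \<Longrightarrow> nrm (s (Suc n) - s n) \<le> e / 2"
      by auto
    hence "nrm (s m - s n) < e" if "m \<ge> N" "n \<ge> N" for m n
      using Cauchy_telescope[of N s "e / 2" m n] that \<open>e / 2 > 0\<close> by fastforce
    thus ?thesis
      by blast
  qed
  thus ?thesis
    using complete that by blast
qed

subsection \<open>Unconditional sums\<close>

text \<open>A Gauss norm bound phrased without a supremum, so that it makes sense for every power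
  series and not only for bounded ones.\<close>

definition gauss_le :: "'c fps \<Rightarrow> real \<Rightarrow> bool" where
  "gauss_le f B \<longleftrightarrow> (\<forall>i. nrm (f $ i) \<le> B)"

lemma gauss_le_add: "gauss_le f B \<Longrightarrow> gauss_le g B \<Longrightarrow> gauss_le (f + g) B"
  by (auto simp: gauss_le_def intro: nrm_add_le)

lemma gauss_le_diff: "gauss_le f B \<Longrightarrow> gauss_le g B \<Longrightarrow> gauss_le (f - g) B"
  by (auto simp: gauss_le_def intro: nrm_diff_le)

lemma gauss_le_sum:
  "(\<And>x. x \<in> A \<Longrightarrow> gauss_le (f x) B) \<Longrightarrow> B \<ge> 0 \<Longrightarrow> gauss_le (sum f A) B"
  by (auto simp: gauss_le_def fps_sum_nth intro!: nrm_sum_le)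

lemma gauss_le_mult:
  assumes "gauss_le f B" "gauss_le g C"
  shows "gauss_le (f * g) (B * C)"
  unfolding gauss_le_def
proof
  fix i
  have "B \<ge> 0" "C \<ge> 0"
    using assms by (auto simp: gauss_le_def intro: order.trans[OF nrm_ge_0])
  thus "nrm ((f * g) $ i) \<le> B * C"
    using assms unfolding fps_mult_nth gauss_le_def
    by (intro nrm_sum_le) (auto simp: nrm_mult intro!: mult_mono)
qed

lemma gauss_le_const_mult: "gauss_le f B \<Longrightarrow> gauss_le (fps_const c * f) (nrm c * B)"
  by (auto simp: gauss_le_def nrm_mult intro: mult_left_mono)

text \<open>In filter form, several approximations can be combined by \<open>eventually_elim\<close>
  instead of by uniting finite index sets by hand.\<close>

lemma Tsum_iff_eventually:
  "Tsum nrm g S s \<longleftrightarrow>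
     (\<forall>e>0. eventually (\<lambda>F. gauss_le (sum g F - s) e) (finite_subsets_at_top S))"
  by (simp add: Tsum_def gauss_le_def eventually_finite_subsets_at_top)

lemma TsumI:
  "(\<And>e. e > 0 \<Longrightarrow> eventually (\<lambda>F. gauss_le (sum g F - s) e) (finite_subsets_at_top S)) \<Longrightarrow>
     Tsum nrm g S s"
  by (simp add: Tsum_iff_eventually)

lemma TsumD:
  "Tsum nrm g S s \<Longrightarrow> e > 0 \<Longrightarrow>
     eventually (\<lambda>F. gauss_le (sum g F - s) e) (finite_subsets_at_top S)"
  by (simp add: Tsum_iff_eventually)

lemma eventually_finite_subset: "eventually (\<lambda>F. finite F \<and> F \<subseteq> S) (finite_subsets_at_top S)"
  by auto

lemma Tsum_cong:
  assumes "\<And>x. x \<in> S \<Longrightarrow> g x = h x"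
  shows "Tsum nrm g S s \<longleftrightarrow> Tsum nrm h S s"
proof -
  have "eventually (\<lambda>F. sum g F = sum h F) (finite_subsets_at_top S)"
    using assms by (auto intro!: sum.cong)
  hence "eventually (\<lambda>F. gauss_le (sum g F - s) e) (finite_subsets_at_top S) \<longleftrightarrow>
         eventually (\<lambda>F. gauss_le (sum h F - s) e) (finite_subsets_at_top S)" for e
    by (intro eventually_subst) (auto elim: eventually_mono)
  thus ?thesis
    by (simp add: Tsum_iff_eventually)
qed

lemma Csum_iff_Tsum:
  "Csum nrm g S s \<longleftrightarrow> Tsum nrm (\<lambda>x. fps_const (g x)) S (fps_const s)"
proof
  assume C: "Csum nrm g S s"
  show "Tsum nrm (\<lambda>x. fps_const (g x)) S (fps_const s)"
  proof (rule TsumI)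
    fix e :: real assume "e > 0"
    hence "eventually (\<lambda>F. nrm (sum g F - s) < e) (finite_subsets_at_top S)"
      using C by (simp add: Csum_def eventually_finite_subsets_at_top)
    thus "eventually (\<lambda>F. gauss_le ((\<Sum>x\<in>F. fps_const (g x)) - fps_const s) e) (finite_subsets_at_top S)"
      by eventually_elim (use \<open>e > 0\<close> in \<open>auto simp: gauss_le_def fps_sum_nth\<close>)
  qed
next
  assume T: "Tsum nrm (\<lambda>x. fps_const (g x)) S (fps_const s)"
  have "eventually (\<lambda>F. nrm (sum g F - s) < e) (finite_subsets_at_top S)" if "e > 0" for e
  proof -
    \<comment> \<open>\<open>Csum\<close> asks for a strict inequality and \<open>Tsum\<close> for a
      weak one; halving bridges the gap.\<close>
    have "e / 2 > 0"
      using that by simp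
    from TsumD[OF T this] show ?thesis
      by eventually_elim (use that in \<open>auto simp: gauss_le_def fps_sum_nth dest!: spec[of _ 0]\<close>)
  qed
  thus "Csum nrm g S s"
    by (simp add: Csum_def eventually_finite_subsets_at_top)
qed

lemma Tsum_nth:
  assumes "Tsum nrm g S s"
  shows "Csum nrm (\<lambda>x. g x $ i) S (s $ i)"
  unfolding Csum_iff_Tsum
proof (rule TsumI)
  fix e :: real assume e: "e > 0"
  from TsumD[OF assms this]
  show "eventually (\<lambda>F. gauss_le ((\<Sum>x\<in>F. fps_const (g x $ i)) - fps_const (s $ i)) e)
          (finite_subsets_at_top S)"
    by eventually_elim (use e in \<open>auto simp: gauss_le_def fps_sum_nth\<close>)
qed

lemma Tsum_unique:
  assumes "Tsum nrm g S s" "Tsum nrm g S s'"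
  shows "s = s'"
proof (rule fps_ext, rule eq_if_close)
  fix i and e :: real assume e: "e > 0"
  have "eventually (\<lambda>F. gauss_le (sum g F - s) e \<and> gauss_le (sum g F - s') e)
          (finite_subsets_at_top S)"
    by (intro eventually_conj TsumD assms e)
  hence "\<exists>F. gauss_le (sum g F - s) e \<and> gauss_le (sum g F - s') e"
    by (rule eventually_happens'[OF finite_subsets_at_top_neq_bot])
  then obtain F where "gauss_le (sum g F - s) e" "gauss_le (sum g F - s') e"
    by blast
  hence "gauss_le ((sum g F - s') - (sum g F - s)) e"
    using gauss_le_diff by blast
  thus "nrm (s $ i - s' $ i) \<le> e"
    by (simp add: gauss_le_def)
qed

lemma Csum_unique: "Csum nrm g S s \<Longrightarrow> Csum nrm g S s' \<Longrightarrow> s = s'"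
  unfolding Csum_iff_Tsum by (drule (1) Tsum_unique) simp

text \<open>Null families are summable over a complete ultrametric field. The sum is built
  coefficient by coefficient, with estimates uniform in the index, which gives convergence in the
  Gauss norm.\<close>

lemma Tsum_exists:
  assumes "\<And>e. e > 0 \<Longrightarrow> finite {x\<in>S. \<not> gauss_le (g x) e}"
  obtains s where "Tsum nrm g S s"
proof -
  \<comment> \<open>The union over \<open>k \<le> n\<close> makes monotonicity immediate. Outside
    \<open>F n\<close> all terms are at most 1 / (n + 1), so this also bounds the steps of the
    partial sums.\<close>
  define F where "F n = (\<Union>k\<le>n. {x\<in>S. \<not> gauss_le (g x) (1 / Suc k)})" for n
  have F: "finite (F n)" "F n \<subseteq> S" for n
    unfolding F_def by (intro finite_UN_I assms) auto
  have F_mono: "F m \<subseteq> F n" if "m \<le> n" for m n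
    using that by (force simp: F_def)
  have small: "gauss_le (g x) (1 / Suc n)" if "x \<in> S - F n" for x n
    using that by (auto simp: F_def)
  have diff: "gauss_le (sum g G - sum g (F n)) (1 / Suc n)"
    if "finite G" "F n \<subseteq> G" "G \<subseteq> S" for G n
  proof -
    have "sum g G - sum g (F n) = sum g (G - F n)"
      using that by (simp add: sum_diff)
    also have "gauss_le \<dots> (1 / Suc n)"
      using that by (intro gauss_le_sum small) auto
    finally show ?thesis .
  qed
  have diff_nth: "nrm (sum g G $ i - sum g (F n) $ i) \<le> 1 / Suc n"
    if "finite G" "F n \<subseteq> G" "G \<subseteq> S" for G n i
    using diff[OF that] by (simp add: gauss_le_def)
  have "\<exists>L. tends nrm (\<lambda>n. sum g (F n) $ i) L" for i
  proof -
    have "tends nrm (\<lambda>n. sum g (F (Suc n)) $ i - sum g (F n) $ i) 0"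
    proof (rule tendsI)
      fix e :: real assume "e > 0"
      then obtain N where N: "1 / Suc N < e"
        using nat_approx_posE by blast
      have "nrm (sum g (F (Suc n)) $ i - sum g (F n) $ i - 0) < e" if "n \<ge> N" for n
      proof -
        have "nrm (sum g (F (Suc n)) $ i - sum g (F n) $ i) \<le> 1 / Suc n"
          by (intro diff_nth F F_mono) simp
        also have "\<dots> \<le> 1 / Suc N"
          using that by (simp add: frac_le)
        finally show ?thesis
          using N by simp
      qed
      thus "\<exists>N. \<forall>n\<ge>N. nrm (sum g (F (Suc n)) $ i - sum g (F n) $ i - 0) < e"
        by blast
    qed
    thus ?thesis
      by (rule convergent_if_steps_tend_0) blast
  qed
  then obtain L where L: "\<And>i. tends nrm (\<lambda>n. sum g (F n) $ i) (L i)"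
    by metis
  have "Tsum nrm g S (Abs_fps L)"
  proof (rule TsumI)
    fix e :: real assume "e > 0"
    then obtain N where N: "1 / Suc N < e"
      using nat_approx_posE by blast
    have "eventually (\<lambda>G. finite G \<and> F N \<subseteq> G \<and> G \<subseteq> S) (finite_subsets_at_top S)"
      unfolding eventually_finite_subsets_at_top using F by blast
    thus "eventually (\<lambda>G. gauss_le (sum g G - Abs_fps L) e) (finite_subsets_at_top S)"
    proof eventually_elim
      case (elim G)
      show ?case
        unfolding gauss_le_def
      proof
        fix i
        have "nrm (L i - sum g G $ i) \<le> 1 / Suc N"
        proof (rule tends_nrm_le[OF L])
          fix n assume n: "n \<ge> N"
          have "nrm ((sum g (F n) $ i - sum g (F N) $ i) - (sum g G $ i - sum g (F N) $ i)) \<le> 1 / Suc N"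
            using elim n by (intro nrm_diff_le[of "_ - _" _ "_ - _"] diff_nth F F_mono) auto
          thus "nrm (sum g (F n) $ i - sum g G $ i) \<le> 1 / Suc N"
            by simp
        qed
        thus "nrm ((sum g G - Abs_fps L) $ i) \<le> e"
          using N by (simp add: nrm_minus_commute)
      qed
    qed
  qed
  thus ?thesis
    using that by blast
qed

section \<open>Bounds, images and rearrangements of unconditional sums\<close>

lemma gauss_le_mono: "gauss_le f B \<Longrightarrow> B \<le> C \<Longrightarrow> gauss_le f C"
  unfolding gauss_le_def by (meson order.trans)

lemma Tsum_gauss_le:
  assumes "Tsum nrm g S s" "\<And>x. x \<in> S \<Longrightarrow> gauss_le (g x) B" "B \<ge> 0"
  shows "gauss_le s B"
  unfolding gauss_le_def
proof (rule allI, rule field_le_epsilon)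
  fix i and e :: real assume e: "e > 0"
  have "eventually (\<lambda>F. gauss_le (sum g F - s) e \<and> finite F \<and> F \<subseteq> S) (finite_subsets_at_top S)"
    by (intro eventually_conj TsumD[OF assms(1)] eventually_finite_subset e)
  hence "\<exists>F. gauss_le (sum g F - s) e \<and> finite F \<and> F \<subseteq> S"
    by (rule eventually_happens'[OF finite_subsets_at_top_neq_bot])
  then obtain F where F: "gauss_le (sum g F - s) e" "F \<subseteq> S"
    by blast
  have "gauss_le (sum g F) B"
    using F assms by (intro gauss_le_sum) auto
  hence "gauss_le (sum g F - (sum g F - s)) (B + e)"
    using gauss_le_mono[OF F(1), of "B + e"] gauss_le_mono[of _ B "B + e"] e assms(3)
    by (intro gauss_le_diff[of "sum g F" _ "sum g F - s"]) auto
  thus "nrm (s $ i) \<le> B + e"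
    by (simp add: gauss_le_def)
qed

lemma Csum_nrm_le:
  assumes "Csum nrm g S s" "\<And>x. x \<in> S \<Longrightarrow> nrm (g x) \<le> B" "B \<ge> 0"
  shows "nrm s \<le> B"
proof -
  have "gauss_le (fps_const s) B"
    using assms by (intro Tsum_gauss_le[OF assms(1)[unfolded Csum_iff_Tsum]]) (auto simp: gauss_le_def)
  from this[unfolded gauss_le_def, rule_format, of 0] show ?thesis
    by simp
qed

text \<open>Only additivity is asked of \<open>T\<close>, because it must cover the Frobenius twist,
  which is not linear over \<open>'c\<close>, as well as multiplication by a bounded series.\<close>

lemma Tsum_additive_image:
  assumes "Tsum nrm g S s" and add: "\<And>f g. T (f + g) = T f + T g"
    and cont: "\<And>e. e > 0 \<Longrightarrow> \<exists>d>0. \<forall>f. gauss_le f d \<longrightarrow> gauss_le (T f) e"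
  shows "Tsum nrm (\<lambda>x. T (g x)) S (T s)"
proof (rule TsumI)
  fix e :: real assume "e > 0"
  from cont[OF this] obtain d where d: "d > 0" "\<And>f. gauss_le f d \<Longrightarrow> gauss_le (T f) e"
    by blast
  have "T 0 + T 0 = T 0 + 0"
    by (simp flip: add)
  hence T0: "T 0 = 0"
    by (rule add_left_imp_eq)
  have "T (f - g) + T g = T f" for f g
    by (simp flip: add)
  hence T_diff: "T (f - g) = T f - T g" for f g
    by (simp add: eq_diff_eq)
  have T_sum: "T (sum g F) = (\<Sum>x\<in>F. T (g x))" for F
    by (induction F rule: infinite_finite_induct) (simp_all add: T0 add)
  from TsumD[OF assms(1) d(1)]
  show "eventually (\<lambda>F. gauss_le ((\<Sum>x\<in>F. T (g x)) - T s) e) (finite_subsets_at_top S)"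
    by eventually_elim (use d(2) in \<open>simp flip: T_sum T_diff\<close>)
qed

lemma Tsum_mult:
  assumes "Tsum nrm g S s" "gauss_le h B"
  shows "Tsum nrm (\<lambda>x. h * g x) S (h * s)"
proof (rule Tsum_additive_image[OF assms(1)])
  fix e :: real assume "e > 0"
  have "0 \<le> nrm (h $ 0)" "nrm (h $ 0) \<le> B"
    using assms(2) by (simp_all add: gauss_le_def)
  hence B: "B \<ge> 0"
    by linarith
  show "\<exists>d>0. \<forall>f. gauss_le f d \<longrightarrow> gauss_le (h * f) e"
  proof (intro exI conjI allI impI)
    show "e / (B + 1) > 0"
      using \<open>e > 0\<close> B by simp
    fix f assume "gauss_le f (e / (B + 1))"
    from gauss_le_mult[OF assms(2) this]
    have "gauss_le (h * f) (B * (e / (B + 1)))" .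
    moreover have "B * (e / (B + 1)) \<le> e"
      using \<open>e > 0\<close> B by (simp add: field_simps)
    ultimately show "gauss_le (h * f) e"
      by (rule gauss_le_mono)
  qed
qed (simp add: algebra_simps)

lemma gauss_le_fps_const: "gauss_le (fps_const c) (nrm c)"
  by (auto simp: gauss_le_def)

lemma Tsum_const_mult: "Tsum nrm g S s \<Longrightarrow> Tsum nrm (\<lambda>x. fps_const c * g x) S (fps_const c * s)"
  by (rule Tsum_mult[OF _ gauss_le_fps_const])

lemma Tsum_minus:
  assumes "Tsum nrm g S s"
  shows "Tsum nrm (\<lambda>x. - g x) S (- s)"
proof -
  have "fps_const (-1) * f = - f" for f :: "'c fps"
    by (simp add: fps_eq_iff)
  thus ?thesis
    using Tsum_const_mult[OF assms, of "-1"] by (simp only:)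
qed

lemma Csum_times_fps:
  assumes "Csum nrm g S s" "gauss_le h B"
  shows "Tsum nrm (\<lambda>x. fps_const (g x) * h) S (fps_const s * h)"
  using Tsum_mult[OF assms(1)[unfolded Csum_iff_Tsum] assms(2)] by (subst (1 2) mult.commute)

lemma Tsum_reindex:
  assumes "bij_betw \<phi> S S'" "\<And>x. x \<in> S \<Longrightarrow> g' (\<phi> x) = g x"
  shows "Tsum nrm g' S' s \<longleftrightarrow> Tsum nrm g S s"
proof -
  have inj: "inj_on \<phi> S" and img: "S' = \<phi> ` S"
    using assms(1) by (auto simp: bij_betw_def)
  have "eventually (\<lambda>F. sum g' (\<phi> ` F) = sum g F) (finite_subsets_at_top S)"
    using eventually_finite_subset
  proof eventually_elim
    case (elim F)
    thus ?case
      using inj_on_subset[OF inj] assms(2) by (subst sum.reindex) (auto intro!: sum.cong)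
  qed
  hence "eventually (\<lambda>F. gauss_le (sum g' (\<phi> ` F) - s) e) (finite_subsets_at_top S) \<longleftrightarrow>
         eventually (\<lambda>F. gauss_le (sum g F - s) e) (finite_subsets_at_top S)" for e
    by (intro eventually_subst) (auto elim: eventually_mono)
  thus ?thesis
    by (simp add: Tsum_iff_eventually img eventually_filtermap
             flip: filtermap_image_finite_subsets_at_top[OF inj])
qed

lemma Tsum_Un_disjoint:
  assumes "Tsum nrm g S s" "Tsum nrm g S' s'" "S \<inter> S' = {}"
  shows "Tsum nrm g (S \<union> S') (s + s')"
proof (rule TsumI)
  fix e :: real assume e: "e > 0"
  have lim: "filterlim (\<lambda>F. F \<inter> T) (finite_subsets_at_top T) (finite_subsets_at_top (S \<union> S'))"
    if "T \<subseteq> S \<union> S'" for T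
    unfolding filterlim_finite_subsets_at_top
  proof (intro allI impI, elim conjE)
    fix X assume "finite X" "X \<subseteq> T"
    hence "eventually (\<lambda>Y. finite Y \<and> X \<subseteq> Y \<and> Y \<subseteq> S \<union> S') (finite_subsets_at_top (S \<union> S'))"
      using that unfolding eventually_finite_subsets_at_top by (intro exI[of _ X]) auto
    thus "eventually (\<lambda>Y. finite (Y \<inter> T) \<and> X \<subseteq> Y \<inter> T \<and> Y \<inter> T \<subseteq> T) (finite_subsets_at_top (S \<union> S'))"
      by eventually_elim (use \<open>X \<subseteq> T\<close> in auto)
  qed
  have "eventually (\<lambda>F. gauss_le (sum g (F \<inter> S) - s) e) (finite_subsets_at_top (S \<union> S'))"
    by (rule eventually_compose_filterlim[OF TsumD[OF assms(1) e] lim]) auto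
  moreover have "eventually (\<lambda>F. gauss_le (sum g (F \<inter> S') - s') e) (finite_subsets_at_top (S \<union> S'))"
    by (rule eventually_compose_filterlim[OF TsumD[OF assms(2) e] lim]) auto
  ultimately show "eventually (\<lambda>F. gauss_le (sum g F - (s + s')) e) (finite_subsets_at_top (S \<union> S'))"
    using eventually_finite_subset[of "S \<union> S'"]
  proof eventually_elim
    case (elim F)
    have "F = (F \<inter> S) \<union> (F \<inter> S')" "(F \<inter> S) \<inter> (F \<inter> S') = {}"
      using elim assms(3) by blast+
    hence "sum g F = sum g (F \<inter> S) + sum g (F \<inter> S')"
      using elim(3) by (metis finite_Int sum.union_disjoint)
    hence "sum g F - (s + s') = (sum g (F \<inter> S) - s) + (sum g (F \<inter> S') - s')"
      by simp
    thus ?case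
      using gauss_le_add[OF elim(1,2)] by (simp only:)
  qed
qed

text \<open>Each row sum is replaced by a finite partial sum with error at most \<open>e\<close>. In
  the ultrametric setting these errors do not accumulate over the rows.\<close>

lemma Tsum_Sigma:
  assumes "Tsum nrm g (Sigma I J) s" "\<And>i. i \<in> I \<Longrightarrow> Tsum nrm (\<lambda>j. g (i, j)) (J i) (h i)"
  shows "Tsum nrm h I s"
proof (rule TsumI)
  fix e :: real assume e: "e > 0"
  from TsumD[OF assms(1) e] obtain F where F: "finite F" "F \<subseteq> Sigma I J"
    and F': "\<forall>G. finite G \<and> F \<subseteq> G \<and> G \<subseteq> Sigma I J \<longrightarrow> gauss_le (sum g G - s) e"
    unfolding eventually_finite_subsets_at_top by blast
  \<comment> \<open>The fibre of \<open>F\<close> over \<open>i\<close>: if every finite row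
    contains its fibre, the union of the rows contains \<open>F\<close>.\<close>
  define Fi where "Fi i = snd ` (F \<inter> {i} \<times> UNIV)" for i
  have "\<exists>G. gauss_le ((\<Sum>j\<in>G. g (i, j)) - h i) e \<and> finite G \<and> Fi i \<subseteq> G \<and> G \<subseteq> J i"
    if i: "i \<in> I" for i
  proof -
    have Fi: "finite (Fi i)" "Fi i \<subseteq> J i"
      using F by (auto simp: Fi_def)
    have "eventually (\<lambda>G. finite G \<and> Fi i \<subseteq> G \<and> G \<subseteq> J i) (finite_subsets_at_top (J i))"
      unfolding eventually_finite_subsets_at_top using Fi by blast
    hence "eventually (\<lambda>G. gauss_le ((\<Sum>j\<in>G. g (i, j)) - h i) e \<and> finite G \<and> Fi i \<subseteq> G \<and> G \<subseteq> J i)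
             (finite_subsets_at_top (J i))"
      by (intro eventually_conj TsumD[OF assms(2)] i e) (auto elim: eventually_mono)
    thus ?thesis
      by (rule eventually_happens'[OF finite_subsets_at_top_neq_bot])
  qed
  hence "\<forall>i\<in>I. \<exists>G. gauss_le ((\<Sum>j\<in>G. g (i, j)) - h i) e \<and> finite G \<and> Fi i \<subseteq> G \<and> G \<subseteq> J i"
    by blast
  from bchoice[OF this] obtain G where
    G: "\<forall>i\<in>I. gauss_le ((\<Sum>j\<in>G i. g (i, j)) - h i) e \<and> finite (G i) \<and> Fi i \<subseteq> G i \<and> G i \<subseteq> J i"
    by blast
  have "eventually (\<lambda>H. finite H \<and> fst ` F \<subseteq> H \<and> H \<subseteq> I) (finite_subsets_at_top I)"
    unfolding eventually_finite_subsets_at_top using F by (intro exI[of _ "fst ` F"]) auto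
  thus "eventually (\<lambda>H. gauss_le (sum h H - s) e) (finite_subsets_at_top I)"
  proof eventually_elim
    case (elim H)
    have GH: "gauss_le ((\<Sum>j\<in>G i. g (i, j)) - h i) e" "finite (G i)" "Fi i \<subseteq> G i" "G i \<subseteq> J i"
      if "i \<in> H" for i
      using that elim G by auto
    have "F \<subseteq> Sigma H G"
    proof
      fix x assume x: "x \<in> F"
      have "fst x \<in> H"
        using elim x by blast
      moreover have "x \<in> F \<inter> {fst x} \<times> UNIV"
        using x by (cases x) simp
      hence "snd x \<in> Fi (fst x)"
        unfolding Fi_def by (rule imageI)
      ultimately show "x \<in> Sigma H G"
        using GH(3)[of "fst x"] by (cases x) auto
    qed
    moreover have "finite (Sigma H G)"
      using elim GH(2) by (intro finite_SigmaI) auto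
    moreover have "Sigma H G \<subseteq> Sigma I J"
      using elim GH(4) by (intro Sigma_mono) auto
    ultimately have 1: "gauss_le (sum g (Sigma H G) - s) e"
      using F' by blast
    have "sum g (Sigma H G) = (\<Sum>i\<in>H. \<Sum>j\<in>G i. g (i, j))"
      using elim GH(2) by (subst sum.Sigma) auto
    hence "sum h H - s = (sum g (Sigma H G) - s) - (\<Sum>i\<in>H. (\<Sum>j\<in>G i. g (i, j)) - h i)"
      by (simp add: sum_subtractf)
    also have "gauss_le \<dots> e"
      using e by (intro gauss_le_diff[OF 1] gauss_le_sum GH(1)) auto
    finally show ?case .
  qed
qed

lemma Tsum_times_finite:
  assumes "Tsum nrm g S s" "finite C"
  shows "Tsum nrm (\<lambda>(c, x). g x) (C \<times> S) (of_nat (card C) * s)"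
  using assms(2)
proof induction
  case empty
  show ?case
    by (auto simp: Tsum_def)
next
  case (insert c C)
  have "bij_betw snd ({c} \<times> S) S"
    by (auto simp: bij_betw_def inj_on_def image_iff)
  hence "Tsum nrm (\<lambda>(c, x). g x) ({c} \<times> S) s"
    using assms(1) by (subst Tsum_reindex[symmetric, where g' = g and \<phi> = snd]) auto
  from Tsum_Un_disjoint[OF this insert.IH] insert.hyps
  have "Tsum nrm (\<lambda>(c, x). g x) ({c} \<times> S \<union> C \<times> S) (s + of_nat (card C) * s)"
    by auto
  moreover have "{c} \<times> S \<union> C \<times> S = insert c C \<times> S"
    by auto
  ultimately show ?case
    using insert.hyps by (simp add: algebra_simps)
qed

lemma Tsum_exists_inverse_power:
  assumes "\<And>M. finite {x\<in>S. nrm (w x) \<le> M}" "\<And>x. x \<in> S \<Longrightarrow> gauss_le (g x) 1" "k > 0"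
  obtains s where "Tsum nrm (\<lambda>x. fps_const (inverse (w x ^ k)) * g x) S s"
proof (rule Tsum_exists)
  fix e :: real assume e: "e > 0"
  have "gauss_le (fps_const (inverse (w x ^ k)) * g x) e"
    \<comment> \<open>The 1 ensures |w| <= |w|^k, and 1 / e then makes the inverse power at most
      e.\<close>
    if x: "x \<in> S" "nrm (w x) > max 1 (1 / e)" for x
  proof -
    have "gauss_le (fps_const (inverse (w x ^ k)) * g x) (nrm (inverse (w x ^ k)) * 1)"
      using x assms(2) by (intro gauss_le_const_mult) auto
    moreover have "nrm (inverse (w x ^ k)) \<le> e"
    proof -
      have "nrm (w x) \<le> nrm (w x) ^ k"
        using x assms(3) by (simp add: self_le_power)
      hence "nrm (inverse (w x ^ k)) \<le> 1 / nrm (w x)"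
        unfolding inverse_eq_divide nrm_divide nrm_power nrm_1 using x(2) by (intro frac_le) auto
      also have "\<dots> \<le> e"
        using x(2) e less_trans[of 0 1 "nrm (w x)"] by (simp add: pos_divide_le_eq pos_divide_less_eq mult.commute)
      finally show ?thesis .
    qed
    ultimately show ?thesis
      by (simp add: gauss_le_mono)
  qed
  hence "{x\<in>S. \<not> gauss_le (fps_const (inverse (w x ^ k)) * g x) e} \<subseteq> {x\<in>S. nrm (w x) \<le> max 1 (1 / e)}"
    by force
  thus "finite {x\<in>S. \<not> gauss_le (fps_const (inverse (w x ^ k)) * g x) e}"
    using assms(1) finite_subset by blast
qed

lemma Tsum_add:
  assumes "Tsum nrm g S s" "Tsum nrm h S t"
  shows "Tsum nrm (\<lambda>x. g x + h x) S (s + t)"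
proof (rule TsumI)
  fix e :: real assume "e > 0"
  with TsumD[OF assms(1)] TsumD[OF assms(2)]
  have "eventually (\<lambda>F. gauss_le (sum g F - s) e \<and> gauss_le (sum h F - t) e) (finite_subsets_at_top S)"
    by (intro eventually_conj) auto
  thus "eventually (\<lambda>F. gauss_le ((\<Sum>x\<in>F. g x + h x) - (s + t)) e) (finite_subsets_at_top S)"
  proof eventually_elim
    case (elim F)
    thus ?case
      using gauss_le_add[of "sum g F - s" e "sum h F - t"] by (simp add: sum.distrib add_diff_add)
  qed
qed

text \<open>A dominant constant coefficient makes the series a unit of bounded type: solving
  \<open>f * inverse f = 1\<close> for the n-th coefficient leaves, by induction, products of norm
  at most 1.\<close>

lemma gauss_le_inverse:
  assumes "f $ 0 \<noteq> 0" "gauss_le f (nrm (f $ 0))"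
  shows "gauss_le (inverse f) (inverse (nrm (f $ 0)))"
  unfolding gauss_le_def
proof
  fix n
  show "nrm (inverse f $ n) \<le> inverse (nrm (f $ 0))"
  proof (induction n rule: less_induct)
    case (less n)
    show ?case
    proof (cases "n = 0")
      case True
      thus ?thesis
        by (simp add: nrm_inverse)
    next
      case False
      have "(\<Sum>i=0..n. f $ i * inverse f $ (n - i)) = (f * inverse f) $ n"
        by (simp add: fps_mult_nth)
      also have "\<dots> = 0"
        using assms(1) False by (simp add: inverse_mult_eq_1')
      finally have "f $ 0 * inverse f $ n = - (\<Sum>i=1..n. f $ i * inverse f $ (n - i))"
        by (simp add: sum.atLeast_Suc_atMost eq_neg_iff_add_eq_0)
      hence "nrm (f $ 0) * nrm (inverse f $ n) = nrm (\<Sum>i=1..n. f $ i * inverse f $ (n - i))"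
        by (metis nrm_minus nrm_mult)
      also have "\<dots> \<le> 1"
      proof (rule nrm_sum_le)
        fix i assume i: "i \<in> {1..n}"
        have "nrm (f $ i) * nrm (inverse f $ (n - i)) \<le> nrm (f $ 0) * inverse (nrm (f $ 0))"
          using assms(2) less.IH[of "n - i"] i by (intro mult_mono) (auto simp: gauss_le_def)
        thus "nrm (f $ i * inverse f $ (n - i)) \<le> 1"
          using assms(1) by (simp add: nrm_mult)
      qed simp
      finally show ?thesis
        using assms(1) by (simp add: field_simps)
    qed
  qed
qed

end

subsection \<open>Finite fields and power sums\<close>

lemma card_field_ge_2: "CARD('f::{field,finite}) \<ge> 2"
proof -
  have "card {0, 1 :: 'f} \<le> CARD('f)"
    by (intro card_mono) auto
  thus ?thesis
    by simp
qed

text \<open>Multiplication by a nonzero \<open>c\<close> permutes the nonzero elements and so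
  preserves their product.\<close>

lemma finite_field_power_card:
  fixes c :: "'f::{field,finite}"
  shows "c ^ CARD('f) = c"
proof (cases "c = 0")
  case False
  have "(\<Prod>x\<in>UNIV-{0}. c * x) = (\<Prod>x\<in>UNIV-{0}. x)"
    by (rule prod.reindex_bij_witness[of _ "\<lambda>y. y / c" "\<lambda>y. c * y"]) (use False in auto)
  hence "c ^ (CARD('f) - 1) = 1"
    by (simp add: prod.distrib)
  thus ?thesis
    using card_field_ge_2[where 'f = 'f] power_eq_if[of c "CARD('f)"] by auto
qed (use card_field_ge_2[where 'f = 'f] in auto)

lemma finite_field_of_nat_card: "of_nat CARD('f) = (0 :: 'f::{field,finite})"
proof -
  have "(\<Sum>x\<in>UNIV. x + 1) = (\<Sum>x\<in>(UNIV :: 'f set). x)"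
    by (rule sum.reindex_bij_witness[of _ "\<lambda>y. y - 1" "\<lambda>y. y + 1"]) auto
  thus ?thesis
    by (simp add: sum.distrib)
qed

text \<open>Since x^q = x on the field, the middle terms of (x + 1)^q form a polynomial of degree
  below q that vanishes at all q elements. This gives additivity of the q-th power without writing q
  as a prime power.\<close>

lemma finite_field_of_nat_choose:
  assumes "0 < i" "i < CARD('f)"
  shows "of_nat (CARD('f) choose i) = (0 :: 'f::{field,finite})"
proof -
  define q where "q = CARD('f)"
  have q: "q \<ge> 2"
    using card_field_ge_2[where 'f = 'f] by (simp add: q_def)
  define P :: "'f poly" where "P = (\<Sum>i\<in>{0<..<q}. monom (of_nat (q choose i)) i)"
  have "degree P < q"
    unfolding P_def using q by (intro degree_sum_less) (auto intro: le_less_trans[OF degree_monom_le])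
  moreover have "poly P x = 0" for x
  proof -
    have "{..q} = insert 0 (insert q {0<..<q})"
      using q by auto
    hence "(x + 1) ^ q = poly P x + x ^ q + 1"
      using q by (simp add: binomial_ring[of x 1 q] P_def poly_sum poly_monom)
    thus ?thesis
      by (simp add: q_def finite_field_power_card)
  qed
  ultimately have "P = 0"
    using poly_eqI_degree[of UNIV P 0] q by (simp add: q_def)
  moreover have "coeff P i = of_nat (q choose i)"
    using assms by (simp add: P_def coeff_sum q_def)
  ultimately show ?thesis
    by (simp add: q_def)
qed

text \<open>Lagrange interpolation of the additive polynomial \<open>x ^ Q\<close> at the points of \<open>V\<close>.\<close>

lemma subgroup_power_sum:
  fixes V :: "'c::field set"
  assumes V: "finite V" "0 \<in> V" "\<And>x y. x \<in> V \<Longrightarrow> y \<in> V \<Longrightarrow> x - y \<in> V"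
    and Q: "Q > 0" "Q \<le> card V" "\<And>x y :: 'c. (x - y) ^ Q = x ^ Q - y ^ Q"
    and x: "x \<notin> V"
  shows "(\<Sum>b\<in>V. (x - b) ^ (Q - 1)) = (if Q < card V then 0 else \<Prod>b\<in>V-{0}. b)"
proof -
  \<comment> \<open>The common Lagrange denominator: as \<open>V\<close> is a group, translation by
    a node carries the product of its differences from the other nodes into this product.\<close>
  define \<epsilon> where "\<epsilon> = (\<Prod>b\<in>V-{0}. b)"
  define P where "P = (\<Prod>b\<in>V. [:-b, 1:])"
  define L where "L b = (\<Prod>b'\<in>V-{b}. [:-b', 1:])" for b
  define G where "G = (\<Sum>b\<in>V. smult (b ^ Q) (L b))"
  have card_V: "card V > 0"
    using V by (auto simp: card_gt_0_iff)
  have deg_L: "degree (L b) < card V" if "b \<in> V" for b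
    unfolding L_def using that V(1) card_V by (subst degree_prod_sum_eq) auto
  have deg_P: "degree P = card V"
    unfolding P_def by (subst degree_prod_sum_eq) auto
  have "lead_coeff P = 1"
    unfolding P_def lead_coeff_prod by simp
  hence coeff_P: "coeff P (card V) = 1"
    by (simp add: deg_P)
  have L_other: "poly (L b) c = 0" if "c \<in> V" "b \<noteq> c" for b c
    using that V(1) by (auto simp: L_def poly_prod prod_zero_iff)
  have L_same: "poly (L c) c = \<epsilon>" if "c \<in> V" for c
  proof -
    have "poly (L c) c = (\<Prod>b\<in>V-{c}. c - b)"
      by (simp add: L_def poly_prod)
    also have "\<dots> = \<epsilon>"
      unfolding \<epsilon>_def
      by (rule prod.reindex_bij_witness[of _ "\<lambda>b. c - b" "\<lambda>b. c - b"]) (use that V in auto)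
    finally show ?thesis .
  qed
  have interpolate: "poly (\<Sum>b\<in>V. smult (f b) (L b)) c = f c * \<epsilon>" if "c \<in> V" for f c
  proof -
    have "poly (\<Sum>b\<in>V. smult (f b) (L b)) c = (\<Sum>b\<in>V. if b = c then f c * \<epsilon> else 0)"
      unfolding poly_sum using that by (intro sum.cong) (auto simp: L_other L_same)
    also have "\<dots> = f c * \<epsilon>"
      using that V(1) by simp
    finally show ?thesis .
  qed
  have deg_interp: "degree (\<Sum>b\<in>V. smult (f b) (L b)) < card V" for f
    using card_V deg_L by (intro degree_sum_less) (auto intro: le_less_trans[OF degree_smult_le])
  have "(\<Sum>b\<in>V. smult 1 (L b)) = [:\<epsilon>:]"
  proof (rule poly_eqI_degree[of V])
    fix c assume "c \<in> V"
    thus "poly (\<Sum>b\<in>V. smult 1 (L b)) c = poly [:\<epsilon>:] c"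
      by (subst interpolate) auto
  qed (use deg_interp[of "\<lambda>_. 1"] card_V in auto)
  hence "poly (\<Sum>b\<in>V. smult 1 (L b)) x = poly [:\<epsilon>:] x"
    by (rule arg_cong)
  hence sum_L: "(\<Sum>b\<in>V. poly (L b) x) = \<epsilon>"
    by (simp add: poly_sum)
  \<comment> \<open>Both sides agree on \<open>V\<close> and have degree below
    \<open>card V\<close>. If \<open>Q = card V\<close>, a multiple of \<open>P\<close>, which
    vanishes on \<open>V\<close>, removes the leading term.\<close>
  have "G = monom \<epsilon> Q - (if Q < card V then 0 else smult \<epsilon> P)"
    unfolding G_def
  proof (rule poly_eqI_degree[of V])
    fix c assume c: "c \<in> V"
    hence "poly P c = 0"
      using V(1) by (auto simp: P_def poly_prod prod_zero_iff)
    thus "poly (\<Sum>b\<in>V. smult (b ^ Q) (L b)) c =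
          poly (monom \<epsilon> Q - (if Q < card V then 0 else smult \<epsilon> P)) c"
      using c by (subst interpolate) (auto simp: poly_monom)
  next
    show "degree (monom \<epsilon> Q - (if Q < card V then 0 else smult \<epsilon> P)) < card V"
    proof (cases "Q < card V")
      case True
      thus ?thesis
        by (auto intro: le_less_trans[OF degree_monom_le])
    next
      case False
      hence Q_eq: "Q = card V"
        using Q by simp
      have "coeff (monom \<epsilon> Q - smult \<epsilon> P) i = 0" if "i \<ge> card V" for i
        using that coeff_P deg_P by (cases "i = card V") (auto simp: Q_eq coeff_eq_0)
      hence "degree (monom \<epsilon> Q - smult \<epsilon> P) < card V"
        using card_V by (intro degree_lessI) auto
      thus ?thesis
        using False by simp
    qed
  qed (use deg_interp in auto)
  hence G_x: "poly G x = \<epsilon> * x ^ Q - (if Q < card V then 0 else \<epsilon> * poly P x)"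
    by (auto simp: poly_monom)
  have P_x: "poly P x \<noteq> 0"
    using V(1) x by (auto simp: P_def poly_prod prod_zero_iff)
  \<comment> \<open>Multiplying by P(x) turns each summand into the difference of two interpolation
    terms, one for the constant function and one for the Q-th power.\<close>
  have "poly P x * (x - b) ^ (Q - 1) = x ^ Q * poly (L b) x - b ^ Q * poly (L b) x" if b: "b \<in> V" for b
  proof -
    have "poly P x = (x - b) * poly (L b) x"
      using b V(1) by (simp add: P_def L_def poly_prod prod.remove[of V b] algebra_simps)
    hence "poly P x * (x - b) ^ (Q - 1) = ((x - b) * (x - b) ^ (Q - 1)) * poly (L b) x"
      by (simp only: mult_ac)
    also have "(x - b) * (x - b) ^ (Q - 1) = x ^ Q - b ^ Q"
      using Q(1) by (simp flip: Q(3) power_Suc)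
    finally show ?thesis
      by (simp only: left_diff_distrib)
  qed
  hence "poly P x * (\<Sum>b\<in>V. (x - b) ^ (Q - 1)) = x ^ Q * (\<Sum>b\<in>V. poly (L b) x) - poly G x"
    by (simp add: sum_distrib_left G_def poly_sum flip: sum_subtractf)
  also have "\<dots> = poly P x * (if Q < card V then 0 else \<epsilon>)"
    by (simp add: sum_L G_x)
  finally show ?thesis
    using P_x by (simp add: \<epsilon>_def)
qed

subsection \<open>The field and its Frobenius\<close>

locale cinfty =
  fixes \<iota> :: "'f::{field,finite} fls \<Rightarrow> 'c::field" and nrm :: "'c \<Rightarrow> real"
    and q :: nat
  assumes is_Cinfty: "is_Cinfty \<iota> nrm" and q_def: "q = CARD('f)"
begin

sublocale nonarch_field nrm
  using is_Cinfty unfolding is_Cinfty_def by unfold_locales simp_all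

lemma iota_1: "\<iota> 1 = 1" and iota_add: "\<iota> (x + y) = \<iota> x + \<iota> y"
  and iota_mult: "\<iota> (x * y) = \<iota> x * \<iota> y" and nrm_iota: "nrm (\<iota> x) = Kabs x"
  using is_Cinfty unfolding is_Cinfty_def by simp_all

lemma alg_closed:
  fixes P :: "'c poly"
  assumes "degree P \<ge> 1"
  shows "\<exists>x. poly P x = 0"
  using is_Cinfty assms unfolding is_Cinfty_def by blast

lemma q_ge_2: "q \<ge> 2"
  unfolding q_def by (rule card_field_ge_2)

lemma real_q_ge_2: "real q \<ge> 2"
  using q_ge_2 by linarith

lemma q_pos: "q > 0"
  using q_ge_2 by linarith

definition emb :: "'f \<Rightarrow> 'c" where "emb c = \<iota> (fls_const c)"

lemma emb_add: "emb (c + d) = emb c + emb d"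
  by (simp add: emb_def iota_add flip: fls_plus_const)

lemma emb_mult: "emb (c * d) = emb c * emb d"
  by (simp add: emb_def flip: iota_mult)

lemma emb_1 [simp]: "emb 1 = 1"
  by (simp add: emb_def iota_1)

lemma emb_0 [simp]: "emb 0 = 0"
  using emb_add[of 0 0] by (metis add.right_neutral add_left_imp_eq)

lemma emb_minus: "emb (- c) = - emb c"
  using emb_add[of c "- c"] by (simp add: eq_neg_iff_add_eq_0 add.commute)

lemma emb_power: "emb (c ^ n) = emb c ^ n"
  by (induction n) (simp_all add: emb_mult)

lemma emb_of_nat: "emb (of_nat n) = of_nat n"
  by (induction n) (simp_all add: emb_add)

lemma nrm_emb: "nrm (emb c) = (if c = 0 then 0 else 1)"
  using q_pos by (auto simp: q_def emb_def nrm_iota Kabs_def fls_const_nonzero)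

lemma emb_eq_0 [simp]: "emb c = 0 \<longleftrightarrow> c = 0"
  using nrm_emb[of c] by (auto split: if_splits)

lemma of_nat_q: "of_nat q = (0 :: 'c)"
  using emb_of_nat[of q] by (simp add: q_def finite_field_of_nat_card)

lemma frob_add: "(x + y) ^ q = x ^ q + (y :: 'c) ^ q"
proof -
  have "of_nat (q choose i) = (0 :: 'c)" if "0 < i" "i < q" for i
    using emb_of_nat[of "q choose i"] finite_field_of_nat_choose[where 'f = 'f, folded q_def, OF that] by simp
  moreover have "{..q} = insert 0 (insert q {0<..<q})"
    using q_pos by auto
  ultimately show ?thesis
    using q_pos by (simp add: binomial_ring[of x y q] add.commute)
qed

lemma frob_power_add: "(x + y) ^ (q ^ j) = x ^ (q ^ j) + (y :: 'c) ^ (q ^ j)"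
proof (induction j)
  case (Suc j)
  have "(x + y) ^ (q ^ Suc j) = ((x + y) ^ (q ^ j)) ^ q"
    by (simp add: mult.commute flip: power_mult)
  also have "\<dots> = x ^ (q ^ Suc j) + y ^ (q ^ Suc j)"
    by (simp add: Suc.IH frob_add mult.commute flip: power_mult)
  finally show ?case .
qed simp

lemma frob_power_diff: "(x - y) ^ (q ^ j) = x ^ (q ^ j) - (y :: 'c) ^ (q ^ j)"
  using frob_power_add[of "x - y" y j] by (simp add: eq_diff_eq)

lemma frob_diff: "(x - y) ^ q = x ^ q - (y :: 'c) ^ q"
  using frob_power_diff[of x y 1] by simp

lemma frob_sum: "(\<Sum>i\<in>A. f i :: 'c) ^ q = (\<Sum>i\<in>A. f i ^ q)"
  using q_pos by (induction A rule: infinite_finite_induct) (simp_all add: frob_add)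

lemma emb_frob: "emb c ^ q = emb c"
  by (simp add: q_def finite_field_power_card flip: emb_power)

lemma emb_frob_power: "emb c ^ (q ^ j) = emb c"
  by (induction j) (simp_all add: power_mult emb_frob)

abbreviation th :: 'c where "th \<equiv> theta \<iota>"

lemma nrm_theta: "nrm th = real q"
  using q_pos by (auto simp: q_def theta_def nrm_iota Kabs_def)

lemma theta_nonzero [simp]: "th \<noteq> 0"
  using nrm_theta q_pos by auto

subsection \<open>The polynomial ring inside the field\<close>

lemma Ac_0 [simp]: "Ac \<iota> 0 = 0"
  by (simp add: Ac_def)

lemma Ac_pCons: "Ac \<iota> (pCons c a) = emb c + th * Ac \<iota> a"
  using emb_0 by (simp add: Ac_def map_poly_pCons emb_def)

lemma Ac_1 [simp]: "Ac \<iota> 1 = 1"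
  using Ac_pCons[of 1 0] by (simp add: one_pCons)

lemma Ac_add: "Ac \<iota> (a + b) = Ac \<iota> a + Ac \<iota> b"
  by (induction a b rule: poly_induct2) (simp_all add: Ac_pCons emb_add algebra_simps)

lemma Ac_smult: "Ac \<iota> (smult c a) = emb c * Ac \<iota> a"
  by (induction a) (simp_all add: Ac_pCons emb_mult algebra_simps)

lemma Ac_minus: "Ac \<iota> (- a) = - Ac \<iota> a"
  using Ac_smult[of "-1" a] by (simp add: emb_minus)

lemma Ac_diff: "Ac \<iota> (a - b) = Ac \<iota> a - Ac \<iota> b"
  using Ac_add[of a "- b"] by (simp add: Ac_minus)

lemma nrm_Ac: "a \<noteq> 0 \<Longrightarrow> nrm (Ac \<iota> a) = real q ^ degree a"
proof (induction a)
  case (pCons c a)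
  show ?case
  proof (cases "a = 0")
    case True
    thus ?thesis
      using pCons by (simp add: Ac_pCons nrm_emb)
  next
    case False
    have *: "nrm (th * Ac \<iota> a) = real q ^ Suc (degree a)"
      using False pCons.IH by (simp add: nrm_mult nrm_theta)
    have "real q ^ Suc (degree a) > 1"
      using real_q_ge_2 by (intro one_less_power) auto
    hence "nrm (emb c) < nrm (th * Ac \<iota> a)"
      unfolding * by (simp add: nrm_emb)
    from nrm_add_eq[OF this] show ?thesis
      using False by (simp add: Ac_pCons add.commute *)
  qed
qed simp

lemma nrm_Ac_ge_1: "a \<noteq> 0 \<Longrightarrow> nrm (Ac \<iota> a) \<ge> 1"
  using q_pos by (simp add: nrm_Ac one_le_power)

lemma Ac_eq_0_iff [simp]: "Ac \<iota> a = 0 \<longleftrightarrow> a = 0"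
  using nrm_Ac_ge_1[of a] by (cases "a = 0") auto

lemma inj_Ac: "inj (Ac \<iota>)"
  by (rule injI) (metis Ac_diff Ac_eq_0_iff eq_iff_diff_eq_0)

text \<open>Formulated by coefficients rather than by \<open>degree\<close>, so that
  \<open>W 0\<close> is {0} although the zero polynomial has degree 0.\<close>

definition W :: "nat \<Rightarrow> 'f poly set" where "W d = {b. \<forall>i\<ge>d. coeff b i = 0}"

lemma W_0: "W 0 = {0}"
  by (auto simp: W_def poly_eq_iff)

lemma W_Suc: "W (Suc d) = (\<lambda>(c, b). pCons c b) ` (UNIV \<times> W d)"
proof (intro equalityI subsetI)
  fix b assume b: "b \<in> W (Suc d)"
  obtain c a where ca: "b = pCons c a"
    by (cases b)
  have "coeff a i = 0" if "i \<ge> d" for i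
    using b ca that by (auto simp: W_def dest: spec[of _ "Suc i"])
  hence "a \<in> W d"
    by (simp add: W_def)
  thus "b \<in> (\<lambda>(c, b). pCons c b) ` (UNIV \<times> W d)"
    using ca by auto
qed (auto simp: W_def coeff_pCons split: nat.splits)

lemma finite_W: "finite (W d)" and card_W: "card (W d) = q ^ d"
proof (induction d)
  case (Suc d)
  case 1
  show ?case
    using Suc by (simp add: W_Suc)
  case 2
  have "inj_on (\<lambda>(c, b). pCons c b) (UNIV \<times> W d)"
    by (auto simp: inj_on_def)
  thus ?case
    using Suc by (simp add: W_Suc card_image card_cartesian_product q_def)
qed (simp_all add: W_0)

lemma degree_less_imp_W: "degree b < d \<Longrightarrow> b \<in> W d"
  by (auto simp: W_def coeff_eq_0)

lemma W_mono: "d \<le> d' \<Longrightarrow> W d \<subseteq> W d'"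
  by (auto simp: W_def)

lemma zero_in_W [simp]: "0 \<in> W d"
  by (simp add: W_def)

lemma nrm_Ac_W:
  assumes "b \<in> W (Suc n)"
  shows "nrm (Ac \<iota> b) \<le> real q ^ n"
proof (cases "b = 0")
  case False
  have "degree b \<le> n"
    using assms by (intro degree_le) (auto simp: W_def)
  thus ?thesis
    using False real_q_ge_2 by (simp add: nrm_Ac power_increasing)
qed simp

text \<open>The discreteness of A, on which all summability proofs below rest.\<close>

lemma finite_Ac_le: "finite {a. nrm (Ac \<iota> a) \<le> M}"
proof -
  obtain n where n: "M < real q ^ n"
    using real_arch_pow[of "real q" M] real_q_ge_2 by auto
  have "a \<in> W n" if "nrm (Ac \<iota> a) \<le> M" for a
  proof (cases "a = 0")
    case False
    have "real q ^ degree a < real q ^ n"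
      using that n False by (simp add: nrm_Ac)
    hence "degree a < n"
      using real_q_ge_2 by (simp add: power_strict_increasing_iff)
    thus ?thesis
      by (rule degree_less_imp_W)
  qed simp
  thus ?thesis
    by (intro finite_subset[OF _ finite_W[of n]]) auto
qed

lemma filterlim_W: "filterlim W (finite_subsets_at_top UNIV) sequentially"
  unfolding filterlim_finite_subsets_at_top
proof (intro allI impI, elim conjE)
  fix X :: "'f poly set" assume X: "finite X"
  \<comment> \<open>\<open>insert 0\<close> keeps \<open>Max\<close> meaningful when
    \<open>X\<close> is empty.\<close>
  define N where "N = Suc (Max (insert 0 (degree ` X)))"
  have N: "X \<subseteq> W N"
    using X by (auto simp: N_def less_Suc_eq_le intro!: degree_less_imp_W)
  have "eventually (\<lambda>n. n \<ge> N) sequentially"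
    by (rule eventually_ge_at_top)
  thus "eventually (\<lambda>n. finite (W n) \<and> X \<subseteq> W n \<and> W n \<subseteq> UNIV) sequentially"
    by eventually_elim (use N W_mono finite_W in blast)
qed

lemma Csum_imp_tends_W:
  assumes "Csum nrm g UNIV s"
  shows "tends nrm (\<lambda>d. \<Sum>b\<in>W d. g b) s"
proof (rule tendsI)
  fix e :: real assume "e > 0"
  hence "eventually (\<lambda>F. nrm (sum g F - s) < e) (finite_subsets_at_top UNIV)"
    using assms by (simp add: Csum_def eventually_finite_subsets_at_top)
  from eventually_compose_filterlim[OF this filterlim_W]
  show "\<exists>N. \<forall>n\<ge>N. nrm (sum g (W n) - s) < e"
    by (simp add: eventually_sequentially)
qed

text \<open>Interpolation on the image of \<open>W d\<close>, a group of order q^d. The product for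
  \<open>j = d\<close> does not involve \<open>x\<close>, which lets it cancel later.\<close>

lemma W_power_sum:
  assumes "x \<notin> range (Ac \<iota>)" "j \<le> d"
  shows "(\<Sum>b\<in>W d. (x - Ac \<iota> b) ^ (q ^ j - 1)) =
           (if j < d then 0 else \<Prod>b\<in>Ac \<iota> ` W d - {0}. b)"
proof -
  have inj: "inj_on (Ac \<iota>) (W d)"
    using inj_Ac by (rule inj_on_subset) auto
  have card: "card (Ac \<iota> ` W d) = q ^ d"
    by (simp add: card_image[OF inj] card_W)
  have "(\<Sum>b\<in>Ac \<iota> ` W d. (x - b) ^ (q ^ j - 1)) =
          (if q ^ j < card (Ac \<iota> ` W d) then 0 else \<Prod>b\<in>Ac \<iota> ` W d - {0}. b)"
  proof (rule subgroup_power_sum)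
    show "0 \<in> Ac \<iota> ` W d"
      by (rule image_eqI[of _ _ 0]) auto
    show "x - y \<in> Ac \<iota> ` W d" if xy: "x \<in> Ac \<iota> ` W d" "y \<in> Ac \<iota> ` W d" for x y
    proof -
      from xy obtain a b where "x = Ac \<iota> a" "y = Ac \<iota> b" "a \<in> W d" "b \<in> W d"
        by blast
      thus ?thesis
        by (intro image_eqI[of _ _ "a - b"]) (auto simp: Ac_diff W_def)
    qed
  qed (use assms q_ge_2 in \<open>auto simp: finite_W card frob_power_diff power_increasing\<close>)
  moreover have "q ^ j < q ^ d \<longleftrightarrow> j < d"
    using q_ge_2 by (simp add: power_strict_increasing_iff)
  ultimately show ?thesis
    by (simp add: sum.reindex[OF inj] card)
qed

subsection \<open>The Carlitz exponential\<close>

lemma Dc_eq: "Dc \<iota> j = (\<Prod>i<j. th ^ (q ^ j) - th ^ (q ^ i))"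
  by (simp add: Dc_def q_def)

lemma Dc_0 [simp]: "Dc \<iota> 0 = 1"
  by (simp add: Dc_eq)

text \<open>The factor with index 0 is split off; Frobenius makes the others q-th powers of the
  factors of \<open>Dc \<iota> j\<close>. This recursion is the source of
  \<open>cexp_theta\<close>.\<close>

lemma Dc_Suc: "Dc \<iota> (Suc j) = (th ^ (q ^ Suc j) - th) * Dc \<iota> j ^ q"
proof -
  have "(th ^ (q ^ j) - th ^ (q ^ i)) ^ q = th ^ (q ^ Suc j) - th ^ (q ^ Suc i)" for i
    by (simp add: frob_diff mult.commute flip: power_mult)
  thus ?thesis
    unfolding Dc_eq prod.lessThan_Suc_shift by (simp add: prod_power_distrib)
qed

text \<open>In each of the j factors the higher power of theta dominates. The result is grouped so
  that the j-th term of the exponential has norm (|x| / q^j)^(q^j).\<close>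

lemma nrm_Dc: "nrm (Dc \<iota> j) = (real q ^ j) ^ (q ^ j)"
proof -
  have "nrm (th ^ (q ^ j) - th ^ (q ^ i)) = real q ^ (q ^ j)" if "i < j" for i
  proof -
    have "real q ^ (q ^ i) < real q ^ (q ^ j)"
      using that q_ge_2 real_q_ge_2 by (intro power_strict_increasing) auto
    thus ?thesis
      by (subst nrm_diff_eq) (simp_all add: nrm_power nrm_theta)
  qed
  hence "nrm (Dc \<iota> j) = (real q ^ (q ^ j)) ^ j"
    by (simp add: Dc_eq nrm_prod)
  thus ?thesis
    by (simp add: mult.commute flip: power_mult)
qed

lemma Dc_nonzero [simp]: "Dc \<iota> j \<noteq> 0"
  using nrm_Dc[of j] q_pos by auto

lemma nrm_cexp_term: "nrm (x ^ (q ^ j) / Dc \<iota> j) = (nrm x / real q ^ j) ^ (q ^ j)"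
  by (simp add: nrm_divide nrm_power nrm_Dc power_divide)

definition cexp :: "'c \<Rightarrow> 'c" where
  "cexp x = clim nrm (\<lambda>n. \<Sum>j<n. x ^ (q ^ j) / Dc \<iota> j)"

lemma le_q_power: "j \<le> q ^ j"
  using q_ge_2 by (simp add: less_imp_le power_gt_expt)

lemma cexp_term_tends_0: "tends nrm (\<lambda>j. x ^ (q ^ j) / Dc \<iota> j) 0"
proof (rule tendsI)
  fix e :: real assume "e > 0"
  obtain N where N: "2 * nrm x < real q ^ N"
    using real_arch_pow[of "real q" "2 * nrm x"] real_q_ge_2 by auto
  obtain M where M: "(1 / 2 :: real) ^ M < e"
    using real_arch_pow_inv[of e "1 / 2"] \<open>e > 0\<close> by auto
  have "nrm (x ^ (q ^ j) / Dc \<iota> j - 0) < e" if j: "j \<ge> max M N" for j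
  proof -
    have "real q ^ N \<le> real q ^ j"
      using j real_q_ge_2 by (intro power_increasing) auto
    hence "nrm x / real q ^ j \<le> 1 / 2"
      using N q_pos by (simp add: field_simps)
    hence "(nrm x / real q ^ j) ^ (q ^ j) \<le> (1 / 2) ^ (q ^ j)"
      by (intro power_mono) auto
    also have "\<dots> \<le> (1 / 2) ^ M"
      using le_q_power[of j] j by (intro power_decreasing) auto
    finally show ?thesis
      using M by (simp add: nrm_cexp_term)
  qed
  thus "\<exists>N. \<forall>j\<ge>N. nrm (x ^ (q ^ j) / Dc \<iota> j - 0) < e"
    by blast
qed

lemma cexp_tends: "tends nrm (\<lambda>n. \<Sum>j<n. x ^ (q ^ j) / Dc \<iota> j) (cexp x)"
proof -
  have "tends nrm (\<lambda>n. (\<Sum>j<Suc n. x ^ (q ^ j) / Dc \<iota> j) - (\<Sum>j<n. x ^ (q ^ j) / Dc \<iota> j)) 0"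
    using cexp_term_tends_0[of x] by simp
  then obtain L where L: "tends nrm (\<lambda>n. \<Sum>j<n. x ^ (q ^ j) / Dc \<iota> j) L"
    by (rule convergent_if_steps_tend_0)
  thus ?thesis
    by (simp add: cexp_def clim_eq)
qed

lemma cexp_eqI: "tends nrm (\<lambda>n. \<Sum>j<n. x ^ (q ^ j) / Dc \<iota> j) L \<Longrightarrow> cexp x = L"
  by (simp add: cexp_def clim_eq)

lemma cexp_remainder:
  assumes "\<And>j. j \<ge> k \<Longrightarrow> nrm (x ^ (q ^ j) / Dc \<iota> j) \<le> B"
  shows "nrm (cexp x - (\<Sum>j<k. x ^ (q ^ j) / Dc \<iota> j)) \<le> B"
proof (rule tends_nrm_le[OF cexp_tends])
  fix n assume n: "n \<ge> k"
  have "{..<n} = {..<k} \<union> {k..<n}"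
    using n by auto
  hence "(\<Sum>j<n. x ^ (q ^ j) / Dc \<iota> j) - (\<Sum>j<k. x ^ (q ^ j) / Dc \<iota> j) = (\<Sum>j=k..<n. x ^ (q ^ j) / Dc \<iota> j)"
    by (subst sum.union_disjoint[symmetric] | simp add: sum.union_disjoint ivl_disj_int)+
  also have "nrm \<dots> \<le> B"
  proof (rule nrm_sum_le)
    show "B \<ge> 0"
      using assms[of k] nrm_ge_0 order.trans by blast
  qed (use assms in auto)
  finally show "nrm ((\<Sum>j<n. x ^ (q ^ j) / Dc \<iota> j) - (\<Sum>j<k. x ^ (q ^ j) / Dc \<iota> j)) \<le> B" .
qed

lemma cexp_add: "cexp (x + y) = cexp x + cexp y"
  using tends_add[OF cexp_tends[of x] cexp_tends[of y]]
  by (intro cexp_eqI) (simp add: frob_power_add add_divide_distrib sum.distrib)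

lemma cexp_emb_mult: "cexp (emb c * x) = emb c * cexp x"
  using tends_cmult[OF cexp_tends[of x], of "emb c"]
  by (intro cexp_eqI) (simp add: power_mult_distrib emb_frob_power sum_distrib_left)

lemma cexp_0 [simp]: "cexp 0 = 0"
  using cexp_emb_mult[of 0 0] by simp

lemma cexp_diff: "cexp (x - y) = cexp x - cexp y"
  using cexp_add[of "x - y" y] by (simp add: eq_diff_eq)

text \<open>Subtracting theta times the series multiplies the j-th term by theta^(q^j) - theta. This
  kills j = 0, and by \<open>Dc_Suc\<close> the rest are q-th powers of the terms with the index
  lowered by one.\<close>

lemma cexp_theta: "cexp (th * x) = th * cexp x + cexp x ^ q"
proof -
  define s where "s n = (\<Sum>j<n. x ^ (q ^ j) / Dc \<iota> j)" for n
  have step: "(\<Sum>j<Suc n. (th * x) ^ (q ^ j) / Dc \<iota> j) = th * s (Suc n) + s n ^ q" for n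
  proof -
    have "(\<Sum>j<Suc n. (th * x) ^ (q ^ j) / Dc \<iota> j) - th * s (Suc n) =
            (\<Sum>j<Suc n. (th ^ (q ^ j) - th) * x ^ (q ^ j) / Dc \<iota> j)"
      by (simp add: s_def sum_distrib_left power_mult_distrib diff_divide_distrib left_diff_distrib
               sum_subtractf mult.assoc flip: times_divide_eq_right del: sum.lessThan_Suc)
    also have "\<dots> = (\<Sum>j<n. (th ^ (q ^ Suc j) - th) * x ^ (q ^ Suc j) / Dc \<iota> (Suc j))"
      by (subst sum.lessThan_Suc_shift) simp
    also have "\<dots> = (\<Sum>j<n. (x ^ (q ^ j) / Dc \<iota> j) ^ q)"
    proof (rule sum.cong)
      fix j
      have "nrm (Dc \<iota> (Suc j)) \<noteq> 0"
        by simp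
      hence "th ^ (q ^ Suc j) - th \<noteq> 0"
        using Dc_Suc[of j] by auto
      moreover have "x ^ (q ^ Suc j) = (x ^ (q ^ j)) ^ q"
        by (simp add: mult.commute flip: power_mult)
      ultimately show "(th ^ (q ^ Suc j) - th) * x ^ (q ^ Suc j) / Dc \<iota> (Suc j) = (x ^ (q ^ j) / Dc \<iota> j) ^ q"
        unfolding Dc_Suc by (simp add: power_divide del: power_Suc)
    qed simp
    also have "\<dots> = s n ^ q"
      by (simp add: s_def frob_sum)
    finally show ?thesis
      by (simp add: algebra_simps)
  qed
  have s: "tends nrm s (cexp x)"
    using cexp_tends[of x] by (simp add: s_def[abs_def])
  have "tends nrm (\<lambda>n. s n ^ q) (cexp x ^ q)"
  proof (rule tendsI)
    fix e :: real assume e: "e > 0"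
    \<comment> \<open>Within radius 1 a q-th power is no larger than its base, which gives
      continuity of Frobenius.\<close>
    hence "min e 1 > 0"
      by simp
    with s obtain N where N: "\<And>n. n \<ge> N \<Longrightarrow> nrm (s n - cexp x) < min e 1"
      unfolding tends_def by blast
    have "nrm (s n ^ q - cexp x ^ q) < e" if "n \<ge> N" for n
    proof -
      have "nrm (s n ^ q - cexp x ^ q) = nrm (s n - cexp x) ^ q"
        by (simp flip: frob_diff nrm_power)
      also have "\<dots> \<le> nrm (s n - cexp x) ^ 1"
        using N[OF that] q_ge_2 by (intro power_decreasing) auto
      also have "\<dots> < e"
        using N[OF that] by simp
      finally show ?thesis .
    qed
    thus "\<exists>N. \<forall>n\<ge>N. nrm (s n ^ q - cexp x ^ q) < e"
      by blast
  qed
  moreover have "tends nrm (\<lambda>n. th * s (Suc n)) (th * cexp x)"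
    using tends_cmult[of "\<lambda>n. s (Suc n)"] s by (simp add: tends_Suc_iff)
  ultimately have "tends nrm (\<lambda>n. \<Sum>j<Suc n. (th * x) ^ (q ^ j) / Dc \<iota> j) (th * cexp x + cexp x ^ q)"
    unfolding step by (intro tends_add)
  thus ?thesis
    by (intro cexp_eqI) (simp only: tends_Suc_iff[of "\<lambda>n. \<Sum>j<n. (th * x) ^ (q ^ j) / Dc \<iota> j"])
qed

text \<open>On this ball the terms from j = 1 on are bounded by powers of |x| / q <= 1 with exponent
  q^j >= k. Taking k = 1 yields a contraction, k = 2 the first-order behaviour at 0.\<close>

lemma cexp_near_identity:
  assumes "nrm x \<le> real q" "1 \<le> k" "k \<le> q"
  shows "nrm (cexp x - x) \<le> (nrm x / real q) ^ k"
proof -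
  have "nrm (cexp x - (\<Sum>j<1. x ^ (q ^ j) / Dc \<iota> j)) \<le> (nrm x / real q) ^ k"
  proof (rule cexp_remainder)
    fix j :: nat assume j: "j \<ge> 1"
    have qj: "q \<le> q ^ j"
      using j q_ge_2 by (simp add: self_le_power)
    hence "real q \<le> real q ^ j"
      using of_nat_mono[OF qj, where 'a = real] by simp
    hence "nrm x / real q ^ j \<le> nrm x / real q"
      using q_pos by (intro divide_left_mono) auto
    hence "(nrm x / real q ^ j) ^ (q ^ j) \<le> (nrm x / real q) ^ (q ^ j)"
      by (intro power_mono) auto
    also have "\<dots> \<le> (nrm x / real q) ^ k"
      using assms qj q_pos by (intro power_decreasing) auto
    finally show "nrm (x ^ (q ^ j) / Dc \<iota> j) \<le> (nrm x / real q) ^ k"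
      by (simp add: nrm_cexp_term)
  qed
  thus ?thesis
    by simp
qed

lemma cexp_contraction: "nrm x \<le> real q \<Longrightarrow> nrm (x - cexp x) \<le> nrm x / real q"
  using cexp_near_identity[of x 1] q_ge_2 by (simp add: nrm_minus_commute)

text \<open>Fixed-point iteration for x = y + (x - cexp x). Additivity of \<open>cexp\<close> turns
  the bound on x - cexp x into a contraction of differences of iterates.\<close>

lemma cexp_surj_on_ball:
  assumes y: "nrm y \<le> real q"
  obtains x where "cexp x = y" "nrm x \<le> nrm y"
proof -
  define z where "z = rec_nat y (\<lambda>_ x. y + (x - cexp x))"
  have z_0: "z 0 = y" and z_Suc: "z (Suc n) = y + (z n - cexp (z n))" for n
    by (simp_all add: z_def)
  have shrink: "nrm x / real q \<le> nrm x" for x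
    using real_q_ge_2 mult_right_mono[of 1 "real q" "nrm x"] by (simp add: field_simps)
  have z_le: "nrm (z n) \<le> nrm y" for n
  proof (induction n)
    case (Suc n)
    have "nrm (z n - cexp (z n)) \<le> nrm (z n) / real q"
      using Suc y by (intro cexp_contraction) auto
    also have "\<dots> \<le> nrm y"
      using shrink[of "z n"] Suc by linarith
    finally show ?case
      unfolding z_Suc by (intro nrm_add_le) auto
  qed (simp add: z_0)
  have step: "nrm (z (Suc n) - z n) \<le> nrm y / real q ^ n" for n
  proof (induction n)
    case 0
    show ?case
      using nrm_diff_le[OF z_le[of 1] z_le[of 0]] by simp
  next
    case (Suc n)
    define d where "d = z (Suc n) - z n"
    have "z (Suc (Suc n)) - z (Suc n) = d - cexp d"
      unfolding z_Suc[of "Suc n"] d_def cexp_diff by (simp add: z_Suc[of n])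
    also have "nrm \<dots> \<le> nrm d / real q"
      using nrm_diff_le[OF z_le z_le] y unfolding d_def by (intro cexp_contraction) (rule order.trans)
    also have "\<dots> \<le> (nrm y / real q ^ n) / real q"
      using Suc unfolding d_def by (intro divide_right_mono) auto
    finally show ?case
      by (simp add: mult.commute)
  qed
  have "tends nrm (\<lambda>n. z (Suc n) - z n) 0"
  proof (rule tendsI)
    fix e :: real assume e: "e > 0"
    obtain N where N: "nrm y / e < real q ^ N"
      using real_arch_pow[of "real q" "nrm y / e"] real_q_ge_2 by auto
    have "nrm (z (Suc n) - z n - 0) < e" if "n \<ge> N" for n
    proof -
      have "real q ^ N \<le> real q ^ n"
        using that real_q_ge_2 by (intro power_increasing) auto
      hence "nrm y / e < real q ^ n"
        using N by linarith
      hence "nrm y / real q ^ n < e"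
        using e q_pos by (simp add: field_simps)
      thus ?thesis
        using step[of n] by simp
    qed
    thus "\<exists>N. \<forall>n\<ge>N. nrm (z (Suc n) - z n - 0) < e"
      by blast
  qed
  then obtain x where x: "tends nrm z x"
    by (rule convergent_if_steps_tend_0)
  have x_le: "nrm x \<le> nrm y"
    using tends_nrm_le[OF x, of 0 0] z_le by simp
  have "tends nrm (\<lambda>n. z (Suc n)) (y + (x - cexp x))"
  proof (rule tends_dominated[OF x, of 0 _ _ 1])
    fix n
    have "z (Suc n) - (y + (x - cexp x)) = (z n - x) - cexp (z n - x)"
      by (simp add: z_Suc cexp_diff)
    also have "nrm \<dots> \<le> nrm (z n - x) / real q"
      using nrm_diff_le[OF z_le[of n] x_le] y by (intro cexp_contraction) linarith
    also have "\<dots> \<le> 1 * nrm (z n - x)"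
      using shrink by simp
    finally show "nrm (z (Suc n) - (y + (x - cexp x))) \<le> 1 * nrm (z n - x)" .
  qed
  hence "x = y + (x - cexp x)"
    using x tends_unique by (simp add: tends_Suc_iff)
  hence "cexp x = y"
    by (simp add: algebra_simps)
  thus ?thesis
    using that x_le by blast
qed

text \<open>If \<open>\<lambda> ^ (q - 1) = - \<theta>\<close>, then \<open>\<lambda>\<close> is \<open>\<theta>\<close>-torsion of the Carlitz module,
  so \<open>\<theta> x\<close> is a period for any \<open>x\<close> with \<open>cexp x = \<lambda>\<close>.\<close>

lemma cexp_nonzero_root:
  obtains x where "x \<noteq> 0" "cexp x = 0" "nrm x \<le> real q ^ 2"
proof -
  have "degree (monom 1 (q - 1) + [:th:]) = q - 1"
    using q_ge_2 by (subst degree_add_eq_left) (auto simp: degree_monom_eq)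
  hence "degree (monom 1 (q - 1) + [:th:]) \<ge> 1"
    using q_ge_2 by simp
  from alg_closed[OF this] obtain l where "l ^ (q - 1) + th = 0"
    by (auto simp: poly_monom)
  hence l: "l ^ (q - 1) = - th"
    by (simp add: eq_neg_iff_add_eq_0)
  hence "nrm (l ^ (q - 1)) = real q"
    by (simp add: nrm_theta)
  hence nrm_l: "nrm l ^ (q - 1) = real q"
    by (simp add: nrm_power)
  \<comment> \<open>The norm of \<open>l\<close> is q^(1/(q-1)), which reaches q only for q = 2; the
    coarse bound serves all q at once.\<close>
  have l_le: "nrm l \<le> real q"
  proof (rule ccontr)
    assume "\<not> nrm l \<le> real q"
    moreover from this have "nrm l \<le> nrm l ^ (q - 1)"
      using q_ge_2 real_q_ge_2 by (intro self_le_power) auto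
    ultimately show False
      using nrm_l by linarith
  qed
  have l_nz: "l \<noteq> 0"
    using l q_ge_2 by (auto simp: power_0_left)
  obtain x where x: "cexp x = l" "nrm x \<le> nrm l"
    using cexp_surj_on_ball[OF l_le] by blast
  have "cexp (th * x) = th * l + l ^ q"
    by (simp add: cexp_theta x(1))
  also have "l ^ q = l * l ^ (q - 1)"
    using q_pos by (simp flip: power_Suc)
  finally have "cexp (th * x) = 0"
    using l by simp
  moreover have "th * x \<noteq> 0"
    using x l_nz by auto
  moreover have "nrm (th * x) \<le> real q ^ 2"
    using x l_le q_pos by (simp add: nrm_mult nrm_theta power2_eq_square)
  ultimately show ?thesis
    using that by blast
qed

end

subsection \<open>Periods\<close>

locale carlitz = cinfty \<iota> nrm q
  for \<iota> :: "'f::{field,finite} fls \<Rightarrow> 'c::field" and nrm :: "'c \<Rightarrow> real" and q :: nat +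
  fixes p :: 'c
  assumes period: "carlitz_period \<iota> nrm p"
begin

lemma cexp_eq_0_iff: "cexp x = 0 \<longleftrightarrow> (\<exists>a. x = p * Ac \<iota> a)"
proof -
  have "cexp x = 0 \<longleftrightarrow> tends nrm (\<lambda>n. \<Sum>j<n. x ^ (q ^ j) / Dc \<iota> j) 0"
    using cexp_tends[of x] cexp_eqI[of x 0] by metis
  thus ?thesis
    using period unfolding carlitz_period_def q_def by simp
qed

lemma cexp_period [simp]: "cexp (p * Ac \<iota> a) = 0"
  using cexp_eq_0_iff by blast

text \<open>The known nonzero period is \<open>p\<close> times a nonzero polynomial, whose norm is
  at least 1, so \<open>p\<close> inherits the bound.\<close>

lemma p_nonzero [simp]: "p \<noteq> 0" and nrm_p_le: "nrm p \<le> real q ^ 2"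
proof -
  obtain x where x: "x \<noteq> 0" "cexp x = 0" "nrm x \<le> real q ^ 2"
    by (rule cexp_nonzero_root)
  then obtain a where a: "x = p * Ac \<iota> a"
    using cexp_eq_0_iff by blast
  thus "p \<noteq> 0"
    using x by auto
  have "nrm p * 1 \<le> nrm p * nrm (Ac \<iota> a)"
    using x a nrm_Ac_ge_1[of a] by (intro mult_left_mono) auto
  also have "\<dots> \<le> real q ^ 2"
    using x a by (simp add: nrm_mult)
  finally show "nrm p \<le> real q ^ 2"
    by simp
qed

section \<open>Exponential sums over polynomials of bounded degree\<close>

lemma nrm_diff_Ac_W:
  assumes "nrm x \<le> real q ^ n" "b \<in> W (Suc n)"
  shows "nrm (x - Ac \<iota> b) \<le> real q ^ n"
  using assms by (intro nrm_diff_le nrm_Ac_W)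

text \<open>From the cutoff \<open>n + k\<close> on, |y v| / q^j is at most |v| / q^n <= 1 for every
  difference v = x - b that occurs. Dividing by v cancels |v| and leaves an error uniform in
  b.\<close>

lemma cexp_W_sum_approx:
  assumes x: "x \<notin> range (Ac \<iota>)" "nrm x \<le> real q ^ n" and y: "nrm y \<le> real q ^ k"
  shows "nrm ((\<Sum>b\<in>W (Suc n). cexp (y * (x - Ac \<iota> b)) * inverse (x - Ac \<iota> b)) -
              (\<Sum>j<n + k. y ^ (q ^ j) / Dc \<iota> j * (\<Sum>b\<in>W (Suc n). (x - Ac \<iota> b) ^ (q ^ j - 1))))
           \<le> inverse (real q ^ n)"
proof -
  have *: "nrm (cexp (y * v) * inverse v - (\<Sum>j<n + k. y ^ (q ^ j) / Dc \<iota> j * v ^ (q ^ j - 1)))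
             \<le> inverse (real q ^ n)" if v: "v \<noteq> 0" "nrm v \<le> real q ^ n" for v
  proof -
    have t: "nrm (cexp (y * v) - (\<Sum>j<n + k. (y * v) ^ (q ^ j) / Dc \<iota> j)) \<le> nrm v / real q ^ n"
    proof (rule cexp_remainder)
      fix j assume j: "j \<ge> n + k"
      have "real q ^ (n + k) \<le> real q ^ j"
        using j real_q_ge_2 by (intro power_increasing) auto
      moreover have "nrm y * nrm v \<le> real q ^ k * nrm v"
        using y by (intro mult_right_mono) auto
      ultimately have "nrm (y * v) / real q ^ j \<le> (real q ^ k * nrm v) / real q ^ (n + k)"
        unfolding nrm_mult using q_pos by (intro frac_le) auto
      also have "\<dots> = nrm v / real q ^ n"
        using q_pos by (simp add: power_add)
      finally have le: "nrm (y * v) / real q ^ j \<le> nrm v / real q ^ n" .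
      have "nrm v / real q ^ n \<le> 1"
        using v q_pos by simp
      with le have le1: "nrm (y * v) / real q ^ j \<le> 1"
        by linarith
      have "(nrm (y * v) / real q ^ j) ^ (q ^ j) \<le> (nrm (y * v) / real q ^ j) ^ 1"
        using le1 q_pos by (intro power_decreasing) auto
      thus "nrm ((y * v) ^ (q ^ j) / Dc \<iota> j) \<le> nrm v / real q ^ n"
        unfolding nrm_cexp_term using le by simp
    qed
    have "(y * v) ^ (q ^ j) / Dc \<iota> j * inverse v = y ^ (q ^ j) / Dc \<iota> j * v ^ (q ^ j - 1)" for j
      using v(1) q_pos power_minus_mult[of "q ^ j" v]
      by (simp add: power_mult_distrib field_simps)
    hence "cexp (y * v) * inverse v - (\<Sum>j<n + k. y ^ (q ^ j) / Dc \<iota> j * v ^ (q ^ j - 1)) =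
          (cexp (y * v) - (\<Sum>j<n + k. (y * v) ^ (q ^ j) / Dc \<iota> j)) * inverse v"
      by (simp only: left_diff_distrib sum_distrib_right)
    also have "nrm \<dots> \<le> (nrm v / real q ^ n) * inverse (nrm v)"
      unfolding nrm_mult nrm_inverse using t by (intro mult_right_mono) auto
    also have "\<dots> = inverse (real q ^ n)"
      using v by (simp add: field_simps)
    finally show ?thesis .
  qed
  have "(\<Sum>b\<in>W (Suc n). cexp (y * (x - Ac \<iota> b)) * inverse (x - Ac \<iota> b)) -
          (\<Sum>j<n + k. y ^ (q ^ j) / Dc \<iota> j * (\<Sum>b\<in>W (Suc n). (x - Ac \<iota> b) ^ (q ^ j - 1))) =
        (\<Sum>b\<in>W (Suc n). cexp (y * (x - Ac \<iota> b)) * inverse (x - Ac \<iota> b) -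
          (\<Sum>j<n + k. y ^ (q ^ j) / Dc \<iota> j * (x - Ac \<iota> b) ^ (q ^ j - 1)))"
    unfolding sum_distrib_left sum_subtractf
    by (rule arg_cong2[where f = minus, OF refl sum.swap])
  also have "nrm \<dots> \<le> inverse (real q ^ n)"
    using x by (intro nrm_sum_le * nrm_diff_Ac_W) auto
  finally show ?thesis .
qed

lemma exists_q_power_gt: "\<exists>N. \<forall>n\<ge>N. M < real q ^ n"
proof -
  obtain N where "M < real q ^ N"
    using real_arch_pow[of "real q" M] real_q_ge_2 by auto
  moreover have "real q ^ N \<le> real q ^ n" if "n \<ge> N" for n
    using that real_q_ge_2 by (intro power_increasing) auto
  ultimately show ?thesis
    by (meson less_le_trans)
qed

lemma tends_0_if_le_inverse_q_power:
  assumes "\<And>n. n \<ge> N \<Longrightarrow> nrm (s (Suc n)) \<le> inverse (real q ^ n)"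
  shows "tends nrm s 0"
proof -
  have "tends nrm (\<lambda>n. s (Suc n)) 0"
  proof (rule tendsI)
    fix e :: real assume e: "e > 0"
    obtain M where M: "\<And>n. n \<ge> M \<Longrightarrow> inverse e < real q ^ n"
      using exists_q_power_gt by blast
    have "nrm (s (Suc n) - 0) < e" if n: "n \<ge> max M N" for n
    proof -
      have "inverse (real q ^ n) < inverse (inverse e)"
        using M[of n] e n by (intro less_imp_inverse_less) auto
      thus ?thesis
        using assms[of n] n by simp
    qed
    thus "\<exists>N. \<forall>n\<ge>N. nrm (s (Suc n) - 0) < e"
      by blast
  qed
  thus ?thesis
    by (simp only: tends_Suc_iff[of s])
qed

text \<open>With k = 1 only exponents j < n + 1 survive the cutoff. As \<open>W (Suc n)\<close> has
  dimension n + 1, all their power sums vanish.\<close>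

lemma cexp_W_sum_tends_0:
  assumes x: "x \<notin> range (Ac \<iota>)" and y: "nrm y \<le> real q"
  shows "tends nrm (\<lambda>d. \<Sum>b\<in>W d. cexp (y * (x - Ac \<iota> b)) * inverse (x - Ac \<iota> b)) 0"
proof -
  obtain N where N: "\<And>n. n \<ge> N \<Longrightarrow> nrm x < real q ^ n"
    using exists_q_power_gt by blast
  show ?thesis
  proof (rule tends_0_if_le_inverse_q_power[of N])
    fix n assume "n \<ge> N"
    from cexp_W_sum_approx[OF x less_imp_le[OF N[OF this]], of y 1] y
    show "nrm (\<Sum>b\<in>W (Suc n). cexp (y * (x - Ac \<iota> b)) * inverse (x - Ac \<iota> b)) \<le> inverse (real q ^ n)"
      using W_power_sum[OF x] by simp
  qed
qed

lemma finite_diff_Ac_le: "finite {b. nrm (x - Ac \<iota> b) \<le> M}"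
proof (rule finite_subset[OF _ finite_Ac_le])
  have "nrm (Ac \<iota> b) \<le> max M (nrm x)" if "nrm (x - Ac \<iota> b) \<le> M" for b
    using that nrm_diff_le[of x "max M (nrm x)" "x - Ac \<iota> b"] by simp
  thus "{b. nrm (x - Ac \<iota> b) \<le> M} \<subseteq> {b. nrm (Ac \<iota> b) \<le> max M (nrm x)}"
    by blast
qed

section \<open>The lattice sum behind u and its relation to the exponential\<close>

definition isum :: "'c \<Rightarrow> 'c" where
  "isum x = (THE s. Csum nrm (\<lambda>a. inverse (x - Ac \<iota> a)) UNIV s)"

lemma uu_eq: "uu \<iota> nrm p x = inverse p * isum x"
  by (simp add: uu_def isum_def)

lemma isum_Csum: "Csum nrm (\<lambda>b. inverse (x - Ac \<iota> b)) UNIV (isum x)"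
proof -
  obtain s where "Tsum nrm (\<lambda>b. fps_const (inverse ((x - Ac \<iota> b) ^ 1)) * 1) UNIV s"
    by (rule Tsum_exists_inverse_power[of UNIV "\<lambda>b. x - Ac \<iota> b" "\<lambda>_. 1" 1])
       (auto simp: finite_diff_Ac_le gauss_le_def)
  from Tsum_nth[OF this, of 0] have *: "Csum nrm (\<lambda>b. inverse (x - Ac \<iota> b)) UNIV (s $ 0)"
    by simp
  hence "isum x = s $ 0"
    unfolding isum_def using Csum_unique by blast
  thus ?thesis
    using * by simp
qed

lemma isum_tends: "tends nrm (\<lambda>d. \<Sum>b\<in>W d. inverse (x - Ac \<iota> b)) (isum x)"
  by (rule Csum_imp_tends_W[OF isum_Csum])

text \<open>With k = 2 just the exponent j = n + 1 survives. Its contribution is the same at both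
  points and cancels in the difference, so its value need not be computed.\<close>

lemma cexp_isum_const:
  assumes x: "x \<notin> range (Ac \<iota>)" and x': "x' \<notin> range (Ac \<iota>)"
  shows "cexp (p * x) * isum x = cexp (p * x') * isum x'"
proof -
  define F where "F x d = (\<Sum>b\<in>W d. cexp (p * (x - Ac \<iota> b)) * inverse (x - Ac \<iota> b))" for x d
  \<comment> \<open>Periodicity replaces cexp (p (x - b)) by cexp (p x), which then factors out of
    the sum.\<close>
  have F: "tends nrm (F x) (cexp (p * x) * isum x)" for x
    using tends_cmult[OF isum_tends, of "cexp (p * x)" x]
    by (simp add: F_def[abs_def] right_diff_distrib cexp_diff sum_distrib_left)
  have approx: "nrm (F x (Suc n) - p ^ (q ^ Suc n) / Dc \<iota> (Suc n) * (\<Prod>b\<in>Ac \<iota> ` W (Suc n) - {0}. b))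
                  \<le> inverse (real q ^ n)" if x: "x \<notin> range (Ac \<iota>)" and n: "nrm x \<le> real q ^ n" for x n
  proof -
    have "(\<Sum>j<n + 2. p ^ (q ^ j) / Dc \<iota> j * (\<Sum>b\<in>W (Suc n). (x - Ac \<iota> b) ^ (q ^ j - 1))) =
          p ^ (q ^ Suc n) / Dc \<iota> (Suc n) * (\<Prod>b\<in>Ac \<iota> ` W (Suc n) - {0}. b)"
      using W_power_sum[OF x, of _ "Suc n"] by (simp del: power_Suc)
    thus ?thesis
      using cexp_W_sum_approx[OF x n nrm_p_le] unfolding F_def by (simp only:)
  qed
  obtain N where N: "\<And>n. n \<ge> N \<Longrightarrow> nrm x < real q ^ n"
    using exists_q_power_gt by blast
  obtain N' where N': "\<And>n. n \<ge> N' \<Longrightarrow> nrm x' < real q ^ n"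
    using exists_q_power_gt by blast
  have "tends nrm (\<lambda>d. F x d - F x' d) 0"
  proof (rule tends_0_if_le_inverse_q_power[of "max N N'"])
    fix n assume "n \<ge> max N N'"
    hence "nrm x \<le> real q ^ n" "nrm x' \<le> real q ^ n"
      using N N' by (auto intro: less_imp_le)
    from nrm_diff_le[OF approx[OF x this(1)] approx[OF x' this(2)]]
    show "nrm (F x (Suc n) - F x' (Suc n)) \<le> inverse (real q ^ n)"
      by simp
  qed
  moreover have "tends nrm (\<lambda>d. F x d - F x' d) (cexp (p * x) * isum x - cexp (p * x') * isum x')"
    by (intro tends_diff F)
  ultimately show ?thesis
    using tends_unique by fastforce
qed

lemma not_range_Ac: "0 < nrm x \<Longrightarrow> nrm x < 1 \<Longrightarrow> x \<notin> range (Ac \<iota>)"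
  using nrm_Ac_ge_1 by force

text \<open>The constant value is found by letting \<open>x\<close> tend to \<open>0\<close>.\<close>

lemma cexp_isum:
  assumes "x \<notin> range (Ac \<iota>)"
  shows "cexp (p * x) * isum x = p"
proof (rule eq_if_close)
  fix e :: real assume e: "e > 0"
  obtain N where N: "\<And>n. n \<ge> N \<Longrightarrow> real q ^ 2 / e < real q ^ n"
    using exists_q_power_gt by blast
  \<comment> \<open>The 2 gives q^2 |y| <= 1, which puts p y into the ball where \<open>cexp\<close>
    is close to the identity; \<open>N\<close> gives q^2 |y| <= e.\<close>
  define n where "n = max N 2"
  define y where "y = inverse (th ^ n)"
  have nrm_y: "nrm y = inverse (real q ^ n)"
    by (simp add: y_def nrm_inverse nrm_power nrm_theta)
  have "real q ^ 2 \<le> real q ^ n"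
    using real_q_ge_2 by (intro power_increasing) (auto simp: n_def)
  hence y2: "real q ^ 2 * nrm y \<le> 1"
    using q_pos unfolding nrm_y by (simp add: field_simps)
  have "1 < real q ^ n"
    using real_q_ge_2 by (intro one_less_power) (auto simp: n_def)
  hence y_lt_1: "nrm y < 1"
    unfolding nrm_y by (simp add: inverse_less_1_iff)
  have ye: "real q ^ 2 * nrm y \<le> e"
    using N[of n] e q_pos unfolding nrm_y by (simp add: n_def field_simps less_imp_le)
  have y_nz: "y \<noteq> 0"
    by (simp add: y_def)
  \<comment> \<open>Close to 0 only the pole at b = 0 is large: for b nonzero, |y - b| = |b| >=
    1.\<close>
  have "nrm (isum y - inverse y) \<le> 1"
  proof (rule tends_nrm_le[OF isum_tends])
    fix d
    have "(\<Sum>b\<in>W d. inverse (y - Ac \<iota> b)) - inverse y = (\<Sum>b\<in>W d - {0}. inverse (y - Ac \<iota> b))"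
      using finite_W[of d] by (simp add: sum.remove[of "W d" 0])
    also have "nrm \<dots> \<le> 1"
    proof (rule nrm_sum_le)
      fix b assume b: "b \<in> W d - {0}"
      have "nrm (Ac \<iota> b - y) = nrm (Ac \<iota> b)"
        using b y_lt_1 nrm_Ac_ge_1[of b] by (intro nrm_diff_eq) auto
      thus "nrm (inverse (y - Ac \<iota> b)) \<le> 1"
        using b nrm_Ac_ge_1[of b]
        by (simp add: nrm_inverse nrm_minus_commute[of y] inverse_le_1_iff)
    qed simp
    finally show "nrm ((\<Sum>b\<in>W d. inverse (y - Ac \<iota> b)) - inverse y) \<le> 1" .
  qed
  note r = this
  have py_le: "nrm (p * y) \<le> real q ^ 2 * nrm y"
    unfolding nrm_mult using nrm_p_le by (intro mult_right_mono) auto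
  hence py_q: "nrm (p * y) \<le> real q"
    using y2 real_q_ge_2 by linarith
  have "nrm (cexp (p * y) - p * y) \<le> nrm (p * y) / real q"
    using cexp_contraction[OF py_q] by (simp add: nrm_minus_commute)
  also have "\<dots> \<le> nrm (p * y)"
    using real_q_ge_2 mult_right_mono[of 1 "real q" "nrm (p * y)"] by (simp add: field_simps)
  finally have "nrm ((cexp (p * y) - p * y) + p * y) \<le> nrm (p * y)"
    by (intro nrm_add_le) auto
  hence cexp_py: "nrm (cexp (p * y)) \<le> real q ^ 2 * nrm y"
    using py_le by simp
  \<comment> \<open>A second-order estimate, because this difference is about to be divided by
    y.\<close>
  have "nrm (cexp (p * y) - p * y) \<le> (nrm (p * y) / real q) ^ 2"
    using q_ge_2 by (intro cexp_near_identity py_q) auto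
  also have "\<dots> \<le> (real q ^ 2 * nrm y / real q) ^ 2"
    using py_le by (intro power_mono divide_right_mono) auto
  also have "\<dots> = real q ^ 2 * nrm y * nrm y"
    using q_pos by (simp add: power2_eq_square)
  finally have "nrm (cexp (p * y) - p * y) / nrm y \<le> real q ^ 2 * nrm y"
    using y_nz by (simp add: pos_divide_le_eq)
  hence 1: "nrm ((cexp (p * y) - p * y) * inverse y) \<le> e"
    using ye by (simp add: nrm_mult nrm_inverse divide_inverse)
  have "nrm (cexp (p * y)) * nrm (isum y - inverse y) \<le> (real q ^ 2 * nrm y) * 1"
    by (intro mult_mono cexp_py r) auto
  hence 2: "nrm (cexp (p * y) * (isum y - inverse y)) \<le> e"
    using ye by (simp add: nrm_mult)
  have "cexp (p * y) * isum y - p = (cexp (p * y) - p * y) * inverse y + cexp (p * y) * (isum y - inverse y)"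
    using y_nz by (simp add: algebra_simps)
  also have "nrm \<dots> \<le> e"
    by (intro nrm_add_le 1 2)
  also have "cexp (p * y) * isum y = cexp (p * x) * isum x"
    using y_nz y_lt_1 by (intro cexp_isum_const assms not_range_Ac) auto
  finally show "nrm (cexp (p * x) * isum x - p) \<le> e" .
qed

lemma isum_eq: "isum x = p * uu \<iota> nrm p x"
  by (simp add: uu_eq)

lemma uu_eq_inverse_cexp:
  assumes "x \<notin> range (Ac \<iota>)"
  shows "uu \<iota> nrm p x = inverse (cexp (p * x))" "cexp (p * x) \<noteq> 0"
proof -
  have "cexp (p * x) * uu \<iota> nrm p x = 1"
    using cexp_isum[OF assms] by (simp add: isum_eq)
  thus "uu \<iota> nrm p x = inverse (cexp (p * x))" "cexp (p * x) \<noteq> 0"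
    by (auto simp: inverse_unique)
qed

subsection \<open>The function \<open>\<chi>\<^sub>t\<close>\<close>

lemma At_0 [simp]: "At \<iota> 0 = 0"
  using emb_0 by (simp add: At_def fps_eq_iff emb_def)

lemma At_nth: "At \<iota> a $ i = emb (coeff a i)"
  by (simp add: At_def emb_def)

lemma At_smult: "At \<iota> (smult c a) = fps_const (emb c) * At \<iota> a"
  by (simp add: fps_eq_iff At_nth emb_mult)

lemma At_minus: "At \<iota> (- a) = - At \<iota> a"
  by (simp add: fps_eq_iff At_nth emb_minus)

lemma At_pCons: "At \<iota> (pCons c a) = fps_const (emb c) + fps_X * At \<iota> a"
  by (auto simp: fps_eq_iff At_nth coeff_pCons split: nat.splits)

lemma gauss_le_At: "gauss_le (At \<iota> a) 1"
  by (simp add: gauss_le_def At_nth nrm_emb)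

text \<open>The Anderson generating function \<open>\<omega> \<chi>\<^sub>t\<close>.\<close>

definition agf :: "'c \<Rightarrow> 'c fps" where
  "agf z = Abs_fps (\<lambda>i. cexp (p * z / th ^ (i + 1)))"

lemma agf_nth: "agf z $ i = cexp (p / th ^ (i + 1) * z)"
  by (simp add: agf_def)

text \<open>The geometric expansion of 1 / (theta^(q^j) - t) in t produces the factor theta^(q^j (i
  + 1)). It is a q^j-th power and moves into the argument.\<close>

lemma cexp_div_theta:
  "clim nrm (\<lambda>n. \<Sum>j<n. x ^ (q ^ j) / (th ^ (q ^ j * (i + 1)) * Dc \<iota> j)) = cexp (x / th ^ (i + 1))"
proof -
  have "x ^ (q ^ j) / (th ^ (q ^ j * (i + 1)) * Dc \<iota> j) = (x / th ^ (i + 1)) ^ (q ^ j) / Dc \<iota> j" for j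
    by (simp only: power_divide power_mult[symmetric] mult.commute[of "i + 1"] divide_divide_eq_left)
  thus ?thesis
    unfolding cexp_def by (simp only:)
qed

lemma omega_eq: "omega \<iota> nrm p = agf 1"
  using cexp_div_theta[of p] by (simp add: omega_def agf_def flip: q_def)

lemma chi_eq: "chi \<iota> nrm p z = inverse (omega \<iota> nrm p) * agf z"
  using cexp_div_theta[of "p * z"] by (simp add: chi_def agf_def power_mult_distrib flip: q_def)

lemma agf_add: "agf (x + y) = agf x + agf y"
  by (simp add: fps_eq_iff agf_nth cexp_add ring_distribs)

lemma agf_emb: "agf (emb c) = fps_const (emb c) * omega \<iota> nrm p"
  by (rule fps_ext) (simp only: agf_nth omega_eq fps_mult_left_const_nth mult_1_right
      mult.commute[of _ "emb c"] cexp_emb_mult)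

lemma agf_theta: "agf (th * z) = fps_const (cexp (p * z)) + fps_X * agf z"
proof (rule fps_ext)
  fix i
  show "agf (th * z) $ i = (fps_const (cexp (p * z)) + fps_X * agf z) $ i"
    by (cases i) (simp_all add: agf_nth)
qed

text \<open>This is chi_t(b) = b(t), by Horner induction: \<open>cexp\<close> vanishes at p b, so
  the constant produced by \<open>agf_theta\<close> disappears on A.\<close>

lemma agf_Ac: "agf (Ac \<iota> b) = At \<iota> b * omega \<iota> nrm p"
proof (induction b)
  case 0
  show ?case
    by (simp add: fps_eq_iff agf_nth)
next
  case (pCons c b)
  thus ?case
    by (simp add: Ac_pCons At_pCons agf_add agf_emb agf_theta algebra_simps)
qed

text \<open>One division by theta already brings the period into the ball |y| <= q, where
  \<open>cexp\<close> is isometric and the exponential sums tend to 0.\<close>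

lemma nrm_p_div_theta: "nrm (p / th ^ (i + 1)) \<le> real q"
proof -
  have "nrm (p / th ^ (i + 1)) \<le> real q ^ 2 / real q ^ 1"
    unfolding nrm_divide nrm_power nrm_theta
    using nrm_p_le q_pos real_q_ge_2 by (intro frac_le power_increasing) auto
  thus ?thesis
    using q_pos by (simp add: power2_eq_square)
qed

lemma nrm_cexp_eq:
  assumes "nrm x \<le> real q"
  shows "nrm (cexp x) = nrm x"
proof (cases "x = 0")
  case False
  have "nrm x / real q < nrm x"
    using real_q_ge_2 False by (simp add: field_simps)
  hence "nrm (x - cexp x) < nrm x"
    using cexp_contraction[OF assms] by linarith
  from nrm_diff_eq[OF this] show ?thesis
    by simp
qed simp

lemma nrm_omega_nth: "nrm (omega \<iota> nrm p $ i) = nrm p / real q ^ (i + 1)"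
  using nrm_cexp_eq[OF nrm_p_div_theta[of i]]
  by (simp add: omega_eq agf_nth nrm_divide nrm_power nrm_mult nrm_theta)

lemma omega_nth_0 [simp]: "omega \<iota> nrm p $ 0 \<noteq> 0"
  using nrm_omega_nth[of 0] q_pos by auto

lemma gauss_le_omega: "gauss_le (omega \<iota> nrm p) (nrm (omega \<iota> nrm p $ 0))"
  unfolding gauss_le_def nrm_omega_nth
proof
  fix i
  have "real q ^ (0 + 1) \<le> real q ^ (i + 1)"
    using real_q_ge_2 by (intro power_increasing) auto
  thus "nrm p / real q ^ (i + 1) \<le> nrm p / real q ^ (0 + 1)"
    using q_pos by (intro divide_left_mono) auto
qed

text \<open>Multiplication by omega turns b(t) into a series with coefficients cexp (y b), |y| <= q.
  Write cexp (y b) = cexp (y x) - cexp (y (x - b)): the second part sums to 0 and the first leaves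
  the sum.\<close>

lemma Tsum_At_div:
  assumes x: "x \<notin> range (Ac \<iota>)"
  shows "Tsum nrm (\<lambda>b. fps_const (inverse (x - Ac \<iota> b)) * At \<iota> b) UNIV (fps_const (isum x) * chi \<iota> nrm p x)"
proof -
  obtain s where "Tsum nrm (\<lambda>b. fps_const (inverse ((x - Ac \<iota> b) ^ 1)) * At \<iota> b) UNIV s"
    by (rule Tsum_exists_inverse_power[of UNIV "\<lambda>b. x - Ac \<iota> b" "At \<iota>" 1])
       (auto simp: finite_diff_Ac_le gauss_le_At)
  hence s: "Tsum nrm (\<lambda>b. fps_const (inverse (x - Ac \<iota> b)) * At \<iota> b) UNIV s"
    by simp
  have "omega \<iota> nrm p * s = fps_const (isum x) * agf x"
  proof (rule fps_ext)
    fix i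
    define y where "y = p / th ^ (i + 1)"
    have "omega \<iota> nrm p * (fps_const (inverse (x - Ac \<iota> b)) * At \<iota> b) =
            fps_const (inverse (x - Ac \<iota> b)) * agf (Ac \<iota> b)" for b
      by (simp add: agf_Ac mult_ac)
    with Tsum_mult[OF s gauss_le_omega]
    have "Tsum nrm (\<lambda>b. fps_const (inverse (x - Ac \<iota> b)) * agf (Ac \<iota> b)) UNIV (omega \<iota> nrm p * s)"
      by simp
    from Csum_imp_tends_W[OF Tsum_nth[OF this, of i]]
    have "tends nrm (\<lambda>d. \<Sum>b\<in>W d. inverse (x - Ac \<iota> b) * cexp (y * Ac \<iota> b)) ((omega \<iota> nrm p * s) $ i)"
      by (simp add: agf_nth y_def)
    moreover have "tends nrm (\<lambda>d. \<Sum>b\<in>W d. cexp (y * (x - Ac \<iota> b)) * inverse (x - Ac \<iota> b)) 0"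
      unfolding y_def by (intro cexp_W_sum_tends_0 x nrm_p_div_theta)
    ultimately have "tends nrm (\<lambda>d. (\<Sum>b\<in>W d. inverse (x - Ac \<iota> b) * cexp (y * Ac \<iota> b)) +
        (\<Sum>b\<in>W d. cexp (y * (x - Ac \<iota> b)) * inverse (x - Ac \<iota> b))) ((omega \<iota> nrm p * s) $ i + 0)"
      by (rule tends_add)
    also have "(\<lambda>d. (\<Sum>b\<in>W d. inverse (x - Ac \<iota> b) * cexp (y * Ac \<iota> b)) +
        (\<Sum>b\<in>W d. cexp (y * (x - Ac \<iota> b)) * inverse (x - Ac \<iota> b))) =
        (\<lambda>d. cexp (y * x) * (\<Sum>b\<in>W d. inverse (x - Ac \<iota> b)))"
      by (simp add: right_diff_distrib cexp_diff left_diff_distrib sum_subtractf sum_distrib_left mult.commute)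
    finally have "(omega \<iota> nrm p * s) $ i = cexp (y * x) * isum x"
      using tends_unique[OF _ tends_cmult[OF isum_tends]] by simp
    thus "(omega \<iota> nrm p * s) $ i = (fps_const (isum x) * agf x) $ i"
      by (simp add: agf_nth y_def mult.commute)
  qed
  hence "inverse (omega \<iota> nrm p) * (omega \<iota> nrm p * s) = fps_const (isum x) * chi \<iota> nrm p x"
    by (simp add: chi_eq mult_ac)
  moreover have "inverse (omega \<iota> nrm p) * (omega \<iota> nrm p * s) = s"
    by (simp add: inverse_mult_eq_1 flip: mult.assoc)
  ultimately show ?thesis
    using s by simp
qed

section \<open>The Frobenius twist\<close>

definition tau :: "'c fps \<Rightarrow> 'c fps" where "tau f = Abs_fps (\<lambda>i. (f $ i) ^ q)"

lemma ttau_eq: "ttau TYPE('f) f = tau f"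
  by (simp add: ttau_def tau_def flip: q_def)

lemma tau_nth [simp]: "tau f $ i = (f $ i) ^ q"
  by (simp add: tau_def)

lemma tau_add: "tau (f + g) = tau f + tau g"
  by (simp add: fps_eq_iff frob_add)

lemma tau_mult: "tau (f * g) = tau f * tau g"
  by (simp add: fps_eq_iff fps_mult_nth frob_sum power_mult_distrib)

lemma tau_const: "tau (fps_const c) = fps_const (c ^ q)"
  using q_pos by (simp add: fps_eq_iff)

lemma tau_inverse:
  assumes "f $ 0 \<noteq> 0"
  shows "tau (inverse f) = inverse (tau f)"
proof -
  have "tau f * tau (inverse f) = tau 1"
    using assms by (simp add: inverse_mult_eq_1' flip: tau_mult)
  also have "tau 1 = 1"
    using tau_const[of 1] by simp
  finally show ?thesis
    using assms q_pos by (intro fps_inverse_unique[symmetric]) (simp add: mult.commute)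
qed

lemma tau_At: "tau (At \<iota> a) = At \<iota> a"
  by (simp add: fps_eq_iff At_nth emb_frob)

lemma Tsum_tau:
  assumes "Tsum nrm g S s"
  shows "Tsum nrm (\<lambda>x. tau (g x)) S (tau s)"
proof (rule Tsum_additive_image[OF assms tau_add])
  fix e :: real assume e: "e > 0"
  have "gauss_le (tau f) e" if f: "gauss_le f (min e 1)" for f
    unfolding gauss_le_def
  proof
    fix i
    have "nrm (f $ i) ^ q \<le> nrm (f $ i) ^ 1"
      using f q_pos by (intro power_decreasing) (auto simp: gauss_le_def)
    thus "nrm (tau f $ i) \<le> e"
      using f by (auto simp: gauss_le_def nrm_power intro: order.trans)
  qed
  thus "\<exists>d>0. \<forall>f. gauss_le f d \<longrightarrow> gauss_le (tau f) e"
    using e by (intro exI[of _ "min e 1"]) auto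
qed

text \<open>\<open>cexp_theta\<close> coefficient by coefficient: theta times the argument at index
  i is the argument at index i - 1, or p z when i = 0.\<close>

lemma tau_agf: "tau (agf z) = fps_const (cexp (p * z)) + (fps_X - fps_const th) * agf z"
proof (rule fps_ext)
  fix i
  define y where "y = p / th ^ (i + 1) * z"
  have "agf z $ i = cexp y"
    by (simp only: agf_nth y_def)
  hence "tau (agf z) $ i = cexp (th * y) - th * cexp y"
    by (simp add: cexp_theta)
  also have "th * y = p / th ^ i * z"
    by (simp add: y_def)
  also have "cexp (p / th ^ i * z) - th * cexp y = (fps_const (cexp (p * z)) + (fps_X - fps_const th) * agf z) $ i"
    by (cases i) (simp_all add: agf_nth y_def left_diff_distrib)
  finally show "tau (agf z) $ i = (fps_const (cexp (p * z)) + (fps_X - fps_const th) * agf z) $ i" .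
qed

lemma tau_omega: "tau (omega \<iota> nrm p) = (fps_X - fps_const th) * omega \<iota> nrm p"
  using tau_agf[of 1] cexp_period[of 1] by (simp add: omega_eq)

lemma tau_chi:
  "tau (chi \<iota> nrm p z) = chi \<iota> nrm p z + inverse (tau (omega \<iota> nrm p)) * fps_const (cexp (p * z))"
proof -
  have "inverse (tau (omega \<iota> nrm p)) * (fps_X - fps_const th) =
        inverse (omega \<iota> nrm p) * (inverse (fps_X - fps_const th) * (fps_X - fps_const th))"
    by (simp add: tau_omega fps_inverse_mult mult_ac)
  also have "inverse (fps_X - fps_const th) * (fps_X - fps_const th) = 1"
    by (rule inverse_mult_eq_1) simp
  finally have *: "inverse (tau (omega \<iota> nrm p)) * (fps_X - fps_const th) = inverse (omega \<iota> nrm p)"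
    by simp
  have "tau (chi \<iota> nrm p z) = inverse (tau (omega \<iota> nrm p)) * tau (agf z)"
    by (simp add: chi_eq tau_mult tau_inverse)
  also have "\<dots> = inverse (tau (omega \<iota> nrm p)) * fps_const (cexp (p * z)) +
                  inverse (tau (omega \<iota> nrm p)) * (fps_X - fps_const th) * agf z"
    by (simp only: tau_agf distrib_left mult.assoc)
  finally show ?thesis
    by (simp add: * chi_eq)
qed

lemma gauss_le_inverse_tau_omega:
  "gauss_le (inverse (tau (omega \<iota> nrm p))) (inverse (nrm (tau (omega \<iota> nrm p) $ 0)))"
proof (rule gauss_le_inverse)
  show "gauss_le (tau (omega \<iota> nrm p)) (nrm (tau (omega \<iota> nrm p) $ 0))"
    using gauss_le_omega by (auto simp: gauss_le_def nrm_power intro: power_mono)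
qed simp

subsection \<open>Sums over the lattice\<close>

text \<open>\<open>S\<close> plays the role of a transversal for the free action of the nonzero
  scalars, and \<open>g'\<close> is constant on orbits.\<close>

lemma Tsum_scalar_orbits:
  assumes g: "Tsum nrm g S s" and \<phi>: "bij_betw \<phi> ((UNIV - {0 :: 'f}) \<times> S) S'"
    and g': "\<And>c x. c \<noteq> 0 \<Longrightarrow> x \<in> S \<Longrightarrow> g' (\<phi> (c, x)) = g x"
  shows "Tsum nrm g' S' (- s)"
proof -
  have "of_nat (q - 1) = (of_nat q - 1 :: 'c fps)"
    using q_pos by (simp add: of_nat_diff)
  also have "of_nat q = (0 :: 'c fps)"
    by (simp add: fps_of_nat[symmetric] of_nat_q)
  finally have "of_nat (card (UNIV - {0 :: 'f})) * s = - s"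
    by (simp add: card_Diff_singleton flip: q_def)
  with Tsum_times_finite[OF g, of "UNIV - {0 :: 'f}"]
  have "Tsum nrm (\<lambda>(c, x). g x) ((UNIV - {0 :: 'f}) \<times> S) (- s)"
    by simp
  moreover have "g' (\<phi> x) = (case x of (c, x) \<Rightarrow> g x)" if "x \<in> (UNIV - {0}) \<times> S" for x
    using that g' by (cases x) auto
  ultimately show ?thesis
    using Tsum_reindex[OF \<phi>, where g = "\<lambda>(c, x). g x"] by blast
qed

lemma bij_betw_monic_multiples:
  "bij_betw (\<lambda>(c, a). smult c a) ((UNIV - {0}) \<times> Aplus) (UNIV - {0 :: 'f poly})"
  by (rule bij_betw_byWitness[where f' = "\<lambda>a. (lead_coeff a, smult (inverse (lead_coeff a)) a)"])
     (auto simp: Aplus_def)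

lemma bij_betw_monic_multiples_pair:
  "bij_betw (\<lambda>(c, (a, b)). (smult c a, smult c b)) ((UNIV - {0}) \<times> (Aplus \<times> UNIV))
     ((UNIV - {0 :: 'f poly}) \<times> UNIV)"
  by (rule bij_betw_byWitness[where f' = "\<lambda>(a, b).
        (lead_coeff a, (smult (inverse (lead_coeff a)) a, smult (inverse (lead_coeff a)) b))"])
     (auto simp: Aplus_def)

lemma Aplus_nonzero: "a \<in> Aplus \<Longrightarrow> a \<noteq> (0 :: 'f poly)"
  by (auto simp: Aplus_def)

lemma Ac_in_range_iota: "Ac \<iota> a \<in> range \<iota>"
proof (induction a)
  case 0
  have "\<iota> (fls_const 0) = 0"
    using emb_0 by (simp only: emb_def)
  thus ?case
    by (metis Ac_0 rangeI)
next
  case (pCons c a)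
  then obtain k where "Ac \<iota> a = \<iota> k"
    by blast
  hence "Ac \<iota> (pCons c a) = \<iota> (fls_const c + fls_X_inv * k)"
    by (simp add: Ac_pCons emb_def theta_def iota_add iota_mult)
  thus ?case
    by blast
qed

lemma Ac_quotient_in_range_iota: "Ac \<iota> b / Ac \<iota> a \<in> range \<iota>"
proof (cases "a = 0")
  \<comment> \<open>Division by zero yields 0, which is still in the range.\<close>
  case True
  thus ?thesis
    using Ac_in_range_iota[of 0] by simp
next
  case False
  obtain j k where jk: "Ac \<iota> b = \<iota> j" "Ac \<iota> a = \<iota> k"
    using Ac_in_range_iota by blast
  have "k \<noteq> 0"
    using jk False Ac_in_range_iota[of 0] iota_add[of 0 0] by (metis Ac_eq_0_iff add.right_neutral add_cancel_right_right)
  hence "\<iota> k * \<iota> (j / k) = \<iota> j"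
    by (simp flip: iota_mult)
  hence "Ac \<iota> b / Ac \<iota> a = \<iota> (j / k)"
    using False jk by (metis Ac_eq_0_iff nonzero_mult_div_cancel_left)
  thus ?thesis
    by blast
qed

end

subsection \<open>Eisenstein series\<close>

locale carlitz_upper = carlitz \<iota> nrm q p
  for \<iota> :: "'f::{field,finite} fls \<Rightarrow> 'c::field" and nrm :: "'c \<Rightarrow> real" and q :: nat and p :: 'c +
  fixes z :: 'c and r :: real
  assumes r_pos: "r > 0" and r_le: "\<And>k. r \<le> nrm (z - \<iota> k)"
begin

text \<open>Factor out a: the quotient b / a lies in K_infty, from which z keeps distance at least
  r.\<close>

lemma nrm_lattice_ge:
  assumes "a \<noteq> 0"
  shows "nrm (Ac \<iota> a) * r \<le> nrm (Ac \<iota> a * z - Ac \<iota> b)"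
proof -
  obtain k where k: "Ac \<iota> b / Ac \<iota> a = \<iota> k"
    using Ac_quotient_in_range_iota by blast
  have "Ac \<iota> a * z - Ac \<iota> b = Ac \<iota> a * (z - \<iota> k)"
    using assms unfolding k[symmetric] by (simp add: right_diff_distrib)
  thus ?thesis
    using r_le[of k] by (simp add: nrm_mult mult_left_mono)
qed

lemma multiple_notin_Ac:
  assumes "a \<noteq> 0"
  shows "Ac \<iota> a * z \<notin> range (Ac \<iota>)"
proof
  assume "Ac \<iota> a * z \<in> range (Ac \<iota>)"
  then obtain b where "Ac \<iota> a * z = Ac \<iota> b"
    by blast
  hence "nrm (Ac \<iota> a) * r \<le> 0"
    using nrm_lattice_ge[OF assms, of b] by simp
  moreover have "nrm (Ac \<iota> a) * r > 0"
    using assms r_pos by simp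
  ultimately show False
    by linarith
qed

lemma finite_lattice_le: "finite {x \<in> UNIV - {(0, 0)}. nrm (Ac \<iota> (fst x) * z + Ac \<iota> (snd x)) \<le> M}"
proof (rule finite_subset)
  define B where "B = max M (M / r * nrm z)"
  show "{x \<in> UNIV - {(0, 0)}. nrm (Ac \<iota> (fst x) * z + Ac \<iota> (snd x)) \<le> M} \<subseteq>
          {a. nrm (Ac \<iota> a) \<le> M / r} \<times> {b. nrm (Ac \<iota> b) \<le> B}"
  proof
    fix x assume x: "x \<in> {x \<in> UNIV - {(0, 0)}. nrm (Ac \<iota> (fst x) * z + Ac \<iota> (snd x)) \<le> M}"
    obtain a b where x_eq: "x = (a, b)"
      by (cases x)
    hence ab: "nrm (Ac \<iota> a * z + Ac \<iota> b) \<le> M"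
      using x by simp
    hence "M \<ge> 0"
      using nrm_ge_0 order.trans by blast
    have "nrm (Ac \<iota> a) * r \<le> M"
      using ab \<open>M \<ge> 0\<close> nrm_lattice_ge[of a "- b"] by (cases "a = 0") (auto simp: Ac_minus)
    hence a: "nrm (Ac \<iota> a) \<le> M / r"
      using r_pos by (simp add: pos_le_divide_eq)
    have "nrm ((Ac \<iota> a * z + Ac \<iota> b) - Ac \<iota> a * z) \<le> B"
    proof (rule nrm_diff_le)
      show "nrm (Ac \<iota> a * z) \<le> B"
        unfolding nrm_mult B_def using a by (intro max.coboundedI2 mult_right_mono) auto
    qed (use ab in \<open>simp add: B_def\<close>)
    thus "x \<in> {a. nrm (Ac \<iota> a) \<le> M / r} \<times> {b. nrm (Ac \<iota> b) \<le> B}"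
      using a by (simp add: x_eq)
  qed
qed (intro finite_cartesian_product finite_Ac_le)

text \<open>The terms of the double sum are invariant under the diagonal action of \<open>\<F>\<^sub>q\<^sup>*\<close>, which has
  \<open>q - 1 = -1\<close> elements: this is the source of the sign in front of the sums over monic \<open>a\<close>.\<close>

lemma lattice_sum:
  assumes h: "\<And>c a b. h (smult c a, smult c b) = fps_const (emb c) * h (a, b)"
    and h1: "\<And>x. gauss_le (h x) 1" and k: "k > 0" "\<And>c. emb c ^ k = emb c"
    and L: "Tsum nrm (\<lambda>b. fps_const (inverse (Ac \<iota> b ^ k)) * h (0, b)) Aplus L"
    and H: "\<And>a. a \<in> Aplus \<Longrightarrow>
      Tsum nrm (\<lambda>b. fps_const (inverse ((Ac \<iota> a * z - Ac \<iota> b) ^ k)) * h (a, - b)) UNIV (H a)"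
  obtains s where "Tsum nrm H Aplus s"
    "Tsum nrm (\<lambda>(a, b). fps_const (inverse ((Ac \<iota> a * z + Ac \<iota> b) ^ k)) * h (a, b)) (UNIV - {(0, 0)}) (- L - s)"
proof -
  define T where "T = (\<lambda>(a, b). fps_const (inverse ((Ac \<iota> a * z + Ac \<iota> b) ^ k)) * h (a, b))"
  \<comment> \<open>The numerator contributes c and the denominator c^k, and c^k = c on F_q for both
    weights k = 1 and k = q.\<close>
  have T_smult: "T (smult c a, smult c b) = T (a, b)" if "c \<noteq> 0" for c a b
  proof -
    have "Ac \<iota> (smult c a) * z + Ac \<iota> (smult c b) = emb c * (Ac \<iota> a * z + Ac \<iota> b)"
      by (simp add: Ac_smult algebra_simps)
    hence "(Ac \<iota> (smult c a) * z + Ac \<iota> (smult c b)) ^ k = emb c * (Ac \<iota> a * z + Ac \<iota> b) ^ k"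
      by (simp add: power_mult_distrib k(2))
    hence "T (smult c a, smult c b) =
        fps_const (inverse (emb c * (Ac \<iota> a * z + Ac \<iota> b) ^ k) * emb c) * h (a, b)"
      by (simp add: T_def h flip: fps_const_mult mult.assoc)
    also have "inverse (emb c * (Ac \<iota> a * z + Ac \<iota> b) ^ k) * emb c = inverse ((Ac \<iota> a * z + Ac \<iota> b) ^ k)"
      using that by simp
    finally show ?thesis
      by (simp add: T_def)
  qed
  have fin: "finite {x \<in> Aplus \<times> UNIV. nrm (Ac \<iota> (fst x) * z + Ac \<iota> (snd x)) \<le> M}" for M
    by (rule finite_subset[OF _ finite_lattice_le[of M]]) (auto dest: Aplus_nonzero)
  obtain s where "Tsum nrm (\<lambda>x. fps_const (inverse ((Ac \<iota> (fst x) * z + Ac \<iota> (snd x)) ^ k)) * h x)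
      (Aplus \<times> UNIV) s"
    by (rule Tsum_exists_inverse_power[OF fin h1 k(1)])
  hence s: "Tsum nrm T (Aplus \<times> UNIV) s"
    by (simp add: T_def case_prod_unfold)
  have "Tsum nrm (\<lambda>b. T (a, b)) UNIV (H a)" if "a \<in> Aplus" for a
  proof -
    \<comment> \<open>The row sums are known with poles at b, so b is replaced by -b; this is why
      \<open>h\<close> is taken at \<open>- b\<close> in the hypothesis.\<close>
    have bij: "bij_betw uminus UNIV (UNIV :: 'f poly set)"
      by (rule bij_uminus)
    show ?thesis
      by (subst Tsum_reindex[OF bij, where g = "\<lambda>b. fps_const (inverse ((Ac \<iota> a * z - Ac \<iota> b) ^ k)) * h (a, - b)"])
         (simp_all add: T_def Ac_minus H[OF that])
  qed
  with s have "Tsum nrm H Aplus s"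
    by (rule Tsum_Sigma)
  moreover have "Tsum nrm T ((UNIV - {0}) \<times> UNIV) (- s)"
    by (rule Tsum_scalar_orbits[OF s bij_betw_monic_multiples_pair]) (auto simp: T_smult)
  \<comment> \<open>In the row a = 0 the monic b are orbit representatives, which produces the
    L-value with its sign.\<close>
  moreover have "Tsum nrm T ({0} \<times> (UNIV - {0})) (- L)"
  proof -
    have "Tsum nrm (\<lambda>b. T (0, b)) (UNIV - {0}) (- L)"
    proof (rule Tsum_scalar_orbits[OF L bij_betw_monic_multiples])
      fix c :: 'f and b :: "'f poly"
      assume "c \<noteq> 0"
      thus "T (0, case (c, b) of (c, a) \<Rightarrow> smult c a) = fps_const (inverse (Ac \<iota> b ^ k)) * h (0, b)"
        using T_smult[of c 0 b] by (simp add: T_def)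
    qed
    moreover have bij: "bij_betw (Pair 0) (UNIV - {0}) ({0 :: 'f poly} \<times> (UNIV - {0 :: 'f poly}))"
      by (auto simp: bij_betw_def inj_on_def)
    ultimately show ?thesis
      by (subst Tsum_reindex[OF bij, where g = "\<lambda>b. T (0, b)"]) auto
  qed
  ultimately have "Tsum nrm H Aplus s" and
    "Tsum nrm T ({0} \<times> (UNIV - {0}) \<union> (UNIV - {0}) \<times> UNIV) (- L + - s)"
    using Tsum_Un_disjoint[of T "{0} \<times> (UNIV - {0})" "- L" "(UNIV - {0}) \<times> UNIV" "- s"] by auto
  moreover have "{0} \<times> (UNIV - {0}) \<union> (UNIV - {0}) \<times> UNIV = UNIV - {(0 :: 'f poly, 0 :: 'f poly)}"
    by auto
  ultimately show ?thesis
    using that unfolding T_def by simp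
qed

lemma Tsum_0: "Tsum nrm (\<lambda>x. 0) S 0"
  by (rule TsumI) (auto simp: gauss_le_def)

text \<open>In the first component a(t) leaves each row and the row a = 0 is zero, so
  \<open>lattice_sum\<close> applies with L = 0. The weight enters only through the row sum.\<close>

lemma lattice_sum_fst:
  assumes k: "k > 0" "\<And>c. emb c ^ k = emb c"
    and row: "\<And>x. Csum nrm (\<lambda>b. inverse ((x - Ac \<iota> b) ^ k)) UNIV (isum x ^ k)"
  shows "\<exists>S1. Tsum nrm (\<lambda>a. fps_const (uu \<iota> nrm p (Ac \<iota> a * z) ^ k) * (- At \<iota> a)) Aplus S1 \<and>
    Tsum nrm (\<lambda>(a, b). fps_const (inverse ((Ac \<iota> a * z + Ac \<iota> b) ^ k)) * At \<iota> a)
      (UNIV - {(0, 0)}) (fps_const (p ^ k) * S1)"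
proof -
  obtain s where s: "Tsum nrm (\<lambda>a. fps_const (isum (Ac \<iota> a * z) ^ k) * At \<iota> a) Aplus s"
    and T: "Tsum nrm (\<lambda>(a, b). fps_const (inverse ((Ac \<iota> a * z + Ac \<iota> b) ^ k)) * At \<iota> (fst (a, b)))
      (UNIV - {(0, 0)}) (- 0 - s)"
  proof (rule lattice_sum[where h = "\<lambda>x. At \<iota> (fst x)" and L = 0 and k = k])
    fix a
    show "Tsum nrm (\<lambda>b. fps_const (inverse ((Ac \<iota> a * z - Ac \<iota> b) ^ k)) * At \<iota> (fst (a, - b))) UNIV
            (fps_const (isum (Ac \<iota> a * z) ^ k) * At \<iota> a)"
      using Csum_times_fps[OF row gauss_le_At] by simp
  qed (use k in \<open>auto simp: At_smult gauss_le_At Tsum_0\<close>)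
  define S1 where "S1 = fps_const (- inverse (p ^ k)) * s"
  have "fps_const (- inverse (p ^ k)) * (fps_const (isum x ^ k) * f) =
          fps_const (uu \<iota> nrm p x ^ k) * (- f)" for x and f :: "'c fps"
    by (simp add: fps_eq_iff isum_eq power_mult_distrib)
  with Tsum_const_mult[OF s, of "- inverse (p ^ k)"]
  have "Tsum nrm (\<lambda>a. fps_const (uu \<iota> nrm p (Ac \<iota> a * z) ^ k) * (- At \<iota> a)) Aplus S1"
    by (simp only: S1_def)
  moreover have "fps_const (p ^ k) * S1 = - 0 - s"
    by (simp add: S1_def fps_eq_iff)
  ultimately show ?thesis
    using T by (intro exI[of _ S1]) simp
qed

lemma lattice_sum_1:
  assumes L: "Tsum nrm (\<lambda>b. fps_const (inverse (Ac \<iota> b)) * At \<iota> b) Aplus L"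
  shows "\<exists>S1 S2.
         Tsum nrm (\<lambda>a. fps_const (uu \<iota> nrm p (Ac \<iota> a * z)) * (- At \<iota> a)) Aplus S1 \<and>
         Tsum nrm (\<lambda>a. fps_const (uu \<iota> nrm p (Ac \<iota> a * z)) * chi \<iota> nrm p (Ac \<iota> a * z)) Aplus S2 \<and>
         Tsum nrm (\<lambda>(a, b). fps_const (inverse (Ac \<iota> a * z + Ac \<iota> b)) * At \<iota> a)
              (UNIV - {(0, 0)}) (fps_const p * S1) \<and>
         Tsum nrm (\<lambda>(a, b). fps_const (inverse (Ac \<iota> a * z + Ac \<iota> b)) * At \<iota> b)
              (UNIV - {(0, 0)}) (- L + fps_const p * S2)"
proof -
  obtain S1 where S1: "Tsum nrm (\<lambda>a. fps_const (uu \<iota> nrm p (Ac \<iota> a * z)) * (- At \<iota> a)) Aplus S1"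
    "Tsum nrm (\<lambda>(a, b). fps_const (inverse (Ac \<iota> a * z + Ac \<iota> b)) * At \<iota> a)
              (UNIV - {(0, 0)}) (fps_const p * S1)"
    using lattice_sum_fst[of 1] isum_Csum by auto
  obtain s where s: "Tsum nrm (\<lambda>a. - (fps_const (isum (Ac \<iota> a * z)) * chi \<iota> nrm p (Ac \<iota> a * z))) Aplus s"
    and T: "Tsum nrm (\<lambda>(a, b). fps_const (inverse ((Ac \<iota> a * z + Ac \<iota> b) ^ 1)) * At \<iota> (snd (a, b)))
      (UNIV - {(0, 0)}) (- L - s)"
  proof (rule lattice_sum[where h = "\<lambda>x. At \<iota> (snd x)" and L = L and k = 1])
    fix a assume "a \<in> (Aplus :: 'f poly set)"
    from Tsum_minus[OF Tsum_At_div[OF multiple_notin_Ac[OF Aplus_nonzero[OF this]]]]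
    show "Tsum nrm (\<lambda>b. fps_const (inverse ((Ac \<iota> a * z - Ac \<iota> b) ^ 1)) * At \<iota> (snd (a, - b))) UNIV
            (- (fps_const (isum (Ac \<iota> a * z)) * chi \<iota> nrm p (Ac \<iota> a * z)))"
      by (simp add: At_minus)
  qed (use L in \<open>auto simp: At_smult gauss_le_At\<close>)
  \<comment> \<open>The sign undoes the one from replacing b by -b, and 1 / p passes from
    \<open>isum\<close> to \<open>uu\<close>.\<close>
  define S2 where "S2 = fps_const (- inverse p) * s"
  have "fps_const (- inverse p) * (- (fps_const (isum x) * f)) = fps_const (uu \<iota> nrm p x) * f"
    for x and f :: "'c fps"
    by (simp add: fps_eq_iff isum_eq)
  with Tsum_const_mult[OF s, of "- inverse p"]
  have "Tsum nrm (\<lambda>a. fps_const (uu \<iota> nrm p (Ac \<iota> a * z)) * chi \<iota> nrm p (Ac \<iota> a * z)) Aplus S2"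
    by (simp only: S2_def)
  moreover have "- L + fps_const p * S2 = - L - s"
    by (simp add: S2_def fps_eq_iff)
  ultimately show ?thesis
    using T S1 by - (rule exI[of _ S1], rule exI[of _ S2], simp)
qed

text \<open>All terms of isum (a z) are at most 1 / (|a| r), so the relation cexp (p a z) isum (a z)
  = p forces |cexp (p a z)| >= |p| |a| r. Hence u(a z) tends to 0.\<close>

lemma Csum_uu_power:
  assumes "k > 0"
  obtains s where "Csum nrm (\<lambda>a. uu \<iota> nrm p (Ac \<iota> a * z) ^ k) Aplus s"
proof -
  have fin: "finite {a \<in> Aplus. nrm (cexp (p * (Ac \<iota> a * z))) \<le> M}" for M
  proof (rule finite_subset[OF _ finite_Ac_le])
    show "{a \<in> Aplus. nrm (cexp (p * (Ac \<iota> a * z))) \<le> M} \<subseteq> {a. nrm (Ac \<iota> a) \<le> M / (nrm p * r)}"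
    proof safe
      fix a assume a: "a \<in> Aplus" "nrm (cexp (p * (Ac \<iota> a * z))) \<le> M"
      define w where "w = Ac \<iota> a * z"
      have a0: "a \<noteq> 0"
        using a(1) by (rule Aplus_nonzero)
      hence pos: "nrm (Ac \<iota> a) * r > 0"
        using r_pos by simp
      have "nrm (isum w) \<le> inverse (nrm (Ac \<iota> a) * r)"
      proof (rule Csum_nrm_le[OF isum_Csum])
        fix b
        show "nrm (inverse (w - Ac \<iota> b)) \<le> inverse (nrm (Ac \<iota> a) * r)"
          unfolding nrm_inverse w_def using nrm_lattice_ge[OF a0] pos by (intro le_imp_inverse_le) auto
      qed (use r_pos in simp)
      hence "nrm (cexp (p * w)) * nrm (isum w) \<le> M * inverse (nrm (Ac \<iota> a) * r)"
        using a(2) unfolding w_def by (intro mult_mono) (auto intro: order.trans[OF nrm_ge_0])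
      moreover have "nrm (cexp (p * w)) * nrm (isum w) = nrm p"
        using cexp_isum[of w] multiple_notin_Ac[OF a0] by (simp add: w_def flip: nrm_mult)
      ultimately have "nrm p * (nrm (Ac \<iota> a) * r) \<le> M"
        using pos by (simp add: field_simps)
      moreover have "nrm p * r > 0"
        using r_pos by simp
      ultimately show "nrm (Ac \<iota> a) \<le> M / (nrm p * r)"
        by (simp add: pos_le_divide_eq mult_ac)
    qed
  qed
  obtain s where "Tsum nrm (\<lambda>a. fps_const (inverse (cexp (p * (Ac \<iota> a * z)) ^ k)) * 1) Aplus s"
    by (rule Tsum_exists_inverse_power[OF fin, of "\<lambda>_. 1" k]) (use assms in \<open>auto simp: gauss_le_def\<close>)
  moreover have "fps_const (inverse (cexp (p * (Ac \<iota> a * z)) ^ k)) * 1 = fps_const (uu \<iota> nrm p (Ac \<iota> a * z) ^ k)"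
    if "a \<in> Aplus" for a
    using uu_eq_inverse_cexp(1)[OF multiple_notin_Ac[OF Aplus_nonzero[OF that]]] by (simp add: power_inverse)
  ultimately have "Tsum nrm (\<lambda>a. fps_const (uu \<iota> nrm p (Ac \<iota> a * z) ^ k)) Aplus s"
    by (subst (asm) Tsum_cong) auto
  from Tsum_nth[OF this, of 0] show ?thesis
    using that by simp
qed

text \<open>Twisting the weight 1 rows gives the weight q rows, as tau fixes b(t). In their value
  the correction term of \<open>tau_chi\<close> meets u^q, and u cexp (p a z) = 1 leaves u^(q-1) /
  tau(omega).\<close>

lemma lattice_sum_q:
  assumes L: "Tsum nrm (\<lambda>b. fps_const (inverse (Ac \<iota> b ^ q)) * At \<iota> b) Aplus L"
  shows "\<exists>S1 S2 s3.
         Tsum nrm (\<lambda>a. fps_const (uu \<iota> nrm p (Ac \<iota> a * z) ^ q) * (- At \<iota> a)) Aplus S1 \<and>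
         Tsum nrm (\<lambda>a. fps_const (uu \<iota> nrm p (Ac \<iota> a * z) ^ q) * chi \<iota> nrm p (Ac \<iota> a * z)) Aplus S2 \<and>
         Csum nrm (\<lambda>a. uu \<iota> nrm p (Ac \<iota> a * z) ^ (q - 1)) Aplus s3 \<and>
         Tsum nrm (\<lambda>(a, b). fps_const (inverse ((Ac \<iota> a * z + Ac \<iota> b) ^ q)) * At \<iota> a)
              (UNIV - {(0, 0)}) (fps_const (p ^ q) * S1) \<and>
         Tsum nrm (\<lambda>(a, b). fps_const (inverse ((Ac \<iota> a * z + Ac \<iota> b) ^ q)) * At \<iota> b)
              (UNIV - {(0, 0)})
              (- L + fps_const (p ^ q) * inverse (tau (omega \<iota> nrm p)) * fps_const s3
                 + fps_const (p ^ q) * S2)"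
proof -
  define V where "V = inverse (tau (omega \<iota> nrm p))"
  have "Csum nrm (\<lambda>b. inverse ((x - Ac \<iota> b) ^ q)) UNIV (isum x ^ q)" for x
    using Tsum_tau[OF isum_Csum[unfolded Csum_iff_Tsum]]
    by (simp add: Csum_iff_Tsum tau_const power_inverse)
  from lattice_sum_fst[OF q_pos emb_frob this] obtain S1 where S1:
    "Tsum nrm (\<lambda>a. fps_const (uu \<iota> nrm p (Ac \<iota> a * z) ^ q) * (- At \<iota> a)) Aplus S1"
    "Tsum nrm (\<lambda>(a, b). fps_const (inverse ((Ac \<iota> a * z + Ac \<iota> b) ^ q)) * At \<iota> a)
              (UNIV - {(0, 0)}) (fps_const (p ^ q) * S1)"
    by blast
  define H where "H a = - tau (fps_const (isum (Ac \<iota> a * z)) * chi \<iota> nrm p (Ac \<iota> a * z))" for a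
  obtain s where s: "Tsum nrm H Aplus s"
    and T: "Tsum nrm (\<lambda>(a, b). fps_const (inverse ((Ac \<iota> a * z + Ac \<iota> b) ^ q)) * At \<iota> (snd (a, b)))
      (UNIV - {(0, 0)}) (- L - s)"
  proof (rule lattice_sum[where h = "\<lambda>x. At \<iota> (snd x)" and L = L and k = q and H = H])
    fix a assume "a \<in> (Aplus :: 'f poly set)"
    from Tsum_minus[OF Tsum_tau[OF Tsum_At_div[OF multiple_notin_Ac[OF Aplus_nonzero[OF this]]]]]
    show "Tsum nrm (\<lambda>b. fps_const (inverse ((Ac \<iota> a * z - Ac \<iota> b) ^ q)) * At \<iota> (snd (a, - b))) UNIV (H a)"
      by (simp add: At_minus H_def tau_mult tau_const tau_At power_inverse)
  qed (use L in \<open>auto simp: At_smult gauss_le_At q_pos emb_frob\<close>)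
  obtain s3 where s3: "Csum nrm (\<lambda>a. uu \<iota> nrm p (Ac \<iota> a * z) ^ (q - 1)) Aplus s3"
    using Csum_uu_power[of "q - 1"] q_ge_2 by auto
  \<comment> \<open>The rescaled row sums minus the correction: the convergence of the sum of u^q
    chi_t follows from that of these two families.\<close>
  define S2 where "S2 = fps_const (- inverse (p ^ q)) * s + - (fps_const s3 * V)"
  have "Tsum nrm (\<lambda>a. fps_const (- inverse (p ^ q)) * H a + - (fps_const (uu \<iota> nrm p (Ac \<iota> a * z) ^ (q - 1)) * V))
          Aplus S2"
    unfolding S2_def V_def
    by (intro Tsum_add Tsum_minus Tsum_const_mult[OF s] Csum_times_fps[OF s3 gauss_le_inverse_tau_omega])
  moreover have "fps_const (- inverse (p ^ q)) * H a + - (fps_const (uu \<iota> nrm p (Ac \<iota> a * z) ^ (q - 1)) * V) =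
      fps_const (uu \<iota> nrm p (Ac \<iota> a * z) ^ q) * chi \<iota> nrm p (Ac \<iota> a * z)" if "a \<in> Aplus" for a
  proof -
    define w where "w = Ac \<iota> a * z"
    define u where "u = uu \<iota> nrm p w"
    have "u = inverse (cexp (p * w))" "cexp (p * w) \<noteq> 0"
      using uu_eq_inverse_cexp multiple_notin_Ac[OF Aplus_nonzero[OF that]] by (auto simp: u_def w_def)
    hence "u * cexp (p * w) = 1"
      by simp
    moreover have "u ^ q = u ^ (q - 1) * u"
      using power_minus_mult[OF q_pos, of u] by simp
    ultimately have "u ^ q * cexp (p * w) = u ^ (q - 1)"
      by (simp only: mult.assoc mult_1_right)
    hence u: "fps_const (u ^ q) * fps_const (cexp (p * w)) = fps_const (u ^ (q - 1))"
      by simp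
    have "fps_const (- inverse (p ^ q)) * H a = fps_const (- inverse (p ^ q)) * - (fps_const ((p * u) ^ q) * tau (chi \<iota> nrm p w))"
      by (simp add: H_def tau_mult tau_const isum_eq flip: w_def u_def)
    also have "\<dots> = fps_const (u ^ q) * tau (chi \<iota> nrm p w)"
      by (simp add: fps_eq_iff power_mult_distrib)
    also have "\<dots> = fps_const (u ^ q) * chi \<iota> nrm p w + fps_const (u ^ q) * fps_const (cexp (p * w)) * V"
      by (simp only: tau_chi V_def distrib_left mult_ac)
    finally show ?thesis
      unfolding u by (simp flip: w_def u_def)
  qed
  ultimately have "Tsum nrm (\<lambda>a. fps_const (uu \<iota> nrm p (Ac \<iota> a * z) ^ q) * chi \<iota> nrm p (Ac \<iota> a * z)) Aplus S2"
    by (subst (asm) Tsum_cong) auto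
  moreover have "- L + fps_const (p ^ q) * V * fps_const s3 + fps_const (p ^ q) * S2 = - L - s"
  proof -
    have "fps_const (p ^ q) * S2 = - s - fps_const (p ^ q) * (fps_const s3 * V)"
      unfolding S2_def distrib_left by (simp add: fps_eq_iff)
    thus ?thesis
      by (simp add: mult_ac)
  qed
  ultimately show ?thesis
    using S1 s3 T unfolding V_def
    by - (rule exI[of _ S1], rule exI[of _ S2], rule exI[of _ s3], simp only: snd_conv)
qed

end

theorem proposition3p7:
  fixes \<iota> :: "'f::{field,finite} fls \<Rightarrow> 'c::field"
    and nrm :: "'c \<Rightarrow> real"
    and p :: 'c
  assumes "is_Cinfty \<iota> nrm"
    and "carlitz_period \<iota> nrm p"
  shows "\<exists>L1 Lq.
    Tsum nrm (\<lambda>a. fps_const (inverse (Ac \<iota> a)) * At \<iota> a) Aplus L1 \<and>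
    Tsum nrm (\<lambda>a. fps_const (inverse (Ac \<iota> a ^ CARD('f))) * At \<iota> a) Aplus Lq \<and>
    (\<exists>R. \<forall>z \<in> Omega \<iota>. imnorm \<iota> nrm z > R \<longrightarrow>
      (\<exists>S1 S2.
         Tsum nrm (\<lambda>a. fps_const (uu \<iota> nrm p (Ac \<iota> a * z)) * (- At \<iota> a)) Aplus S1 \<and>
         Tsum nrm (\<lambda>a. fps_const (uu \<iota> nrm p (Ac \<iota> a * z)) * chi \<iota> nrm p (Ac \<iota> a * z)) Aplus S2 \<and>
         Tsum nrm (\<lambda>(a, b). fps_const (inverse (Ac \<iota> a * z + Ac \<iota> b)) * At \<iota> a)
              (UNIV - {(0, 0)}) (fps_const p * S1) \<and>
         Tsum nrm (\<lambda>(a, b). fps_const (inverse (Ac \<iota> a * z + Ac \<iota> b)) * At \<iota> b)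
              (UNIV - {(0, 0)}) (- L1 + fps_const p * S2)) \<and>
      (\<exists>S1 S2 s3.
         Tsum nrm (\<lambda>a. fps_const (uu \<iota> nrm p (Ac \<iota> a * z) ^ CARD('f)) * (- At \<iota> a)) Aplus S1 \<and>
         Tsum nrm (\<lambda>a. fps_const (uu \<iota> nrm p (Ac \<iota> a * z) ^ CARD('f)) * chi \<iota> nrm p (Ac \<iota> a * z)) Aplus S2 \<and>
         Csum nrm (\<lambda>a. uu \<iota> nrm p (Ac \<iota> a * z) ^ (CARD('f) - 1)) Aplus s3 \<and>
         Tsum nrm (\<lambda>(a, b). fps_const (inverse ((Ac \<iota> a * z + Ac \<iota> b) ^ CARD('f))) * At \<iota> a)
              (UNIV - {(0, 0)}) (fps_const (p ^ CARD('f)) * S1) \<and>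
         Tsum nrm (\<lambda>(a, b). fps_const (inverse ((Ac \<iota> a * z + Ac \<iota> b) ^ CARD('f))) * At \<iota> b)
              (UNIV - {(0, 0)})
              (- Lq + fps_const (p ^ CARD('f)) * inverse (ttau TYPE('f) (omega \<iota> nrm p)) * fps_const s3
                 + fps_const (p ^ CARD('f)) * S2)))"
proof -
  interpret carlitz \<iota> nrm "CARD('f)" p
    by unfold_locales (use assms in simp_all)
  have "\<exists>L. Tsum nrm (\<lambda>a. fps_const (inverse (Ac \<iota> a ^ k)) * At \<iota> a) Aplus L" if k: "k > 0" for k
  proof -
    have fin: "finite {a \<in> Aplus. nrm (Ac \<iota> a) \<le> M}" for M
      by (rule finite_subset[OF _ finite_Ac_le[of M]]) auto
    show ?thesis
      by (rule Tsum_exists_inverse_power[OF fin _ k, where g = "At \<iota>"]) (auto simp: gauss_le_At)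
  qed
  from this[of 1] this[OF q_pos] obtain L1 Lq
    where L1: "Tsum nrm (\<lambda>a. fps_const (inverse (Ac \<iota> a)) * At \<iota> a) Aplus L1"
      and Lq: "Tsum nrm (\<lambda>a. fps_const (inverse (Ac \<iota> a ^ CARD('f))) * At \<iota> a) Aplus Lq"
    by auto
  \<comment> \<open>The infimum |z|_Im is itself a lower bound for the distances, so it can serve as
    \<open>r\<close>.\<close>
  have upper: "carlitz_upper \<iota> nrm CARD('f) p z (imnorm \<iota> nrm z)" if "imnorm \<iota> nrm z > 0" for z
  proof unfold_locales
    show "imnorm \<iota> nrm z \<le> nrm (z - \<iota> k)" for k
      unfolding imnorm_def by (rule cInf_lower) (auto intro!: bdd_belowI[of _ 0])
  qed (fact that)
  note sums = carlitz_upper.lattice_sum_1[OF upper L1] carlitz_upper.lattice_sum_q[OF upper Lq, folded ttau_eq]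
  \<comment> \<open>The threshold is \<open>R = 0\<close>: positive distance from K_infty is large
    enough.\<close>
  show ?thesis
    by (rule exI[of _ L1], rule exI[of _ Lq], intro conjI L1 Lq exI[of _ 0] ballI impI sums)
qed

end
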